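(* Let $k,n$ be integers with $1\leq n<k$, and let $c_j$ ($j\ge0$) be the coefficients defined in the context. For every $\mu>0$ and $j\geq2$, the finite continued fractions defined by $r_{N+1}^{(N)}=0$ and $$r_j^{(N)}=\frac{c_{j-1}}{\mu+c_{j+1}r_{j+1}^{(N)}},\qquad 2\leq j\leq N,$$ converge as $N\to\infty$ to a positive continuous function $r_j(\mu)$ of $\mu\in(0,\infty)$ satisfying $$r_j(\mu)=\frac{c_{j-1}}{\mu+c_{j+1}r_{j+1}(\mu)}.$$ For $\mu>0$, the recurrence $$\mu q_0=-c_1q_1,\qquad c_0q_0=\mu q_1+c_2q_2,\qquad c_{j-1}q_{j-1}=\mu q_j+c_{j+1}q_{j+1}\quad(j\geq2)$$ has a nonzero square-summable solution $(q_j)_{j\ge0}$ if and only if $$G_{k,n}(\mu):=\mu+c_2r_2(\mu)-\frac{-c_0c_1}{\mu}=0.$$ Consequently, $G_{k,n}$ has exactly one positive root $\mu_{k,n}$, and $$\lambda_{k,n}=\frac{nk\,\mu_{k,n}}{2}.$$ Moreover, $$\max\{0,-c_0c_1-c_1c_2\}\leq\mu_{k,n}^2<-c_0c_1.$$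
   Context: The coefficients are $$c_0=\frac{2(n^2-k^2)}{n^2+1},\qquad c_{2m}=\frac{(2m)^2k^2+n^2-k^2}{(2m)^2k^2+n^2+1}\ (m\geq1),\qquad c_{2m+1}=\frac{1+k^2}{(2m+1)^2k^2+n^2}\ (m\geq0).$$ Definition of $\lambda_{k,n}$: on $\mathbb{T}^2=(\mathbb{R}/2\pi\mathbb{Z})^2$, for $s\ge 0$ let $X^s=H^{s-1}_0(\mathbb{T}^2;\mathbb{C})\times H^s(\mathbb{T}^2;\mathbb{C})\ni(\omega,F)$ (subscript $0$: mean zero), and let $$\mathscr{L}_k=-k\cos(kx_1)\,\partial_{x_2}\begin{pmatrix}0 & A_k \\ B_k & 0\end{pmatrix},\qquad A_k=I-(1+k^2)(1-\Delta)^{-1},\quad B_k=-(1+k^2)\Delta^{-1},$$ a bounded operator on $X^s$. The cosine chain of transverse frequency $n$ is the $\mathscr{L}_k$-invariant subspace of pairs $\omega=h(x_1)\sin(nx_2)$, $F=f(x_1)\cos(nx_2)$ with $f\in\overline{\operatorname{span}}\{\cos(2jkx_1):j\geq0\}$, $h\in\overline{\operatorname{span}}\{\cos((2j+1)kx_1):j\geq0\}$. For $1\leq n<k$ the restriction of $\mathscr{L}_k$ to this chain has exactly one positive eigenvalue, denoted $\lambda_{k,n}$. (The recurrence is the eigenvalue equation for $\lambda=nk\mu/2$ in this chain: if $f=\sum_{m\ge0} f_{2m}\cos(2mkx_1)$, $h=\sum_{m\ge0} h_{2m+1}\cos((2m+1)kx_1)$, $x_{2m}=f_{2m}$, $x_{2m+1}=h_{2m+1}$,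 then $q_j=(-1)^{\lfloor j/2\rfloor}x_j$.) *)

theory Defs
  imports "HOL-Analysis.Analysis"
begin

section \<open>Coefficients and continued fractions\<close>

definition coef :: "int \<Rightarrow> int \<Rightarrow> nat \<Rightarrow> real" where
  "coef k n j =
     (if j = 0 then 2 * ((of_int n)\<^sup>2 - (of_int k)\<^sup>2) / ((of_int n)\<^sup>2 + 1)
      else if even j then
        ((of_nat j)\<^sup>2 * (of_int k)\<^sup>2 + (of_int n)\<^sup>2 - (of_int k)\<^sup>2)
          / ((of_nat j)\<^sup>2 * (of_int k)\<^sup>2 + (of_int n)\<^sup>2 + 1)
      else (1 + (of_int k)\<^sup>2) / ((of_nat j)\<^sup>2 * (of_int k)\<^sup>2 + (of_int n)\<^sup>2))"

text \<open>
  \<open>fin_cf k n \<mu> N j\<close> is the finite continued fraction $r_j^{(N)}(\mu)$. Only the indices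
  $2 \le j \le N + 1$ are meaningful.
\<close>
function fin_cf :: "int \<Rightarrow> int \<Rightarrow> real \<Rightarrow> nat \<Rightarrow> nat \<Rightarrow> real" where
  "fin_cf k n \<mu> N j =
     (if N < j then 0
      else coef k n (j - 1) / (\<mu> + coef k n (j + 1) * fin_cf k n \<mu> N (j + 1)))"
  by pat_completeness auto
termination
  by (relation "Wellfounded.measure (\<lambda>(k, n, \<mu>, N, j). Suc N - j)") auto

declare fin_cf.simps [simp del]

definition cf :: "int \<Rightarrow> int \<Rightarrow> nat \<Rightarrow> real \<Rightarrow> real" where
  "cf k n j \<mu> = lim (\<lambda>N. fin_cf k n \<mu> N j)"

definition G :: "int \<Rightarrow> int \<Rightarrow> real \<Rightarrow> real" where
  "G k n \<mu> = \<mu> + coef k n 2 * cf k n 2 \<mu> - (- coef k n 0 * coef k n 1) / \<mu>"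

definition solves_recurrence :: "int \<Rightarrow> int \<Rightarrow> real \<Rightarrow> (nat \<Rightarrow> complex) \<Rightarrow> bool" where
  "solves_recurrence k n \<mu> q \<longleftrightarrow>
     of_real \<mu> * q 0 = - of_real (coef k n 1) * q 1 \<and>
     of_real (coef k n 0) * q 0 = of_real \<mu> * q 1 + of_real (coef k n 2) * q 2 \<and>
     (\<forall>j\<ge>2. of_real (coef k n (j - 1)) * q (j - 1)
              = of_real \<mu> * q j + of_real (coef k n (j + 1)) * q (j + 1))"


section \<open>Sobolev spaces on the torus\<close>

text \<open>
  A periodic distribution on $\mathbb{T}$ or $\mathbb{T}^2$ (complex valued, period $2\pi$) is
  represented by its Fourier coefficients, so that
  $u = \sum_\xi \hat u(\xi) e^{i \xi \cdot x}$. The Sobolev spaces of real order,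
  negative orders included, are defined by the usual weighted $\ell^2$ condition.
\<close>
type_synonym dist1 = "int \<Rightarrow> complex"
type_synonym dist2 = "int \<times> int \<Rightarrow> complex"

definition fourier :: "(real \<Rightarrow> real) \<Rightarrow> dist1" where
  "fourier g a =
     integral {0..2 * pi} (\<lambda>x. of_real (g x) * exp (- \<i> * of_int a * of_real x)) / of_real (2 * pi)"

definition sobolev1 :: "real \<Rightarrow> dist1 set" where
  "sobolev1 s =
     {f. (\<lambda>a. (1 + (of_int a)\<^sup>2) powr s * (cmod (f a))\<^sup>2) summable_on UNIV}"

definition sobolev1_norm :: "real \<Rightarrow> dist1 \<Rightarrow> real" where
  "sobolev1_norm s f =
     sqrt (\<Sum>\<^sub>\<infinity>a. (1 + (of_int a)\<^sup>2) powr s * (cmod (f a))\<^sup>2)"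

text \<open>The closure, in the space of order \<open>s\<close>, of the complex linear span of the sequence \<open>e\<close>.\<close>
definition closed_span :: "real \<Rightarrow> (nat \<Rightarrow> dist1) \<Rightarrow> dist1 set" where
  "closed_span s e =
     {f \<in> sobolev1 s. \<forall>\<epsilon>>0. \<exists>N (\<alpha> :: nat \<Rightarrow> complex).
        sobolev1_norm s (\<lambda>a. f a - (\<Sum>j<N. \<alpha> j * e j a)) < \<epsilon>}"

definition freq_sq :: "int \<times> int \<Rightarrow> real" where
  "freq_sq \<xi> = (of_int (fst \<xi>))\<^sup>2 + (of_int (snd \<xi>))\<^sup>2"

definition sobolev2 :: "real \<Rightarrow> dist2 set" where
  "sobolev2 s = {u. (\<lambda>\<xi>. (1 + freq_sq \<xi>) powr s * (cmod (u \<xi>))\<^sup>2) summable_on UNIV}"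

text \<open>The distribution $f(x_1)\,g(x_2)$.\<close>
definition tensor :: "dist1 \<Rightarrow> dist1 \<Rightarrow> dist2" where
  "tensor f g = (\<lambda>(a, b). f a * g b)"

definition X_space :: "real \<Rightarrow> (dist2 \<times> dist2) set" where
  "X_space s = {\<omega> \<in> sobolev2 (s - 1). \<omega> (0, 0) = 0} \<times> sobolev2 s"


section \<open>The operator and its cosine chains\<close>

definition d2 :: "dist2 \<Rightarrow> dist2" where
  "d2 u = (\<lambda>(a, b). \<i> * of_int b * u (a, b))"

text \<open>Multiplication by $\cos(k x_1) = (e^{i k x_1} + e^{-i k x_1}) / 2$.\<close>
definition mult_cos :: "int \<Rightarrow> dist2 \<Rightarrow> dist2" where
  "mult_cos k u = (\<lambda>(a, b). (u (a - k, b) + u (a + k, b)) / 2)"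

text \<open>
  The Fourier multipliers $(1-\Delta)^{-1}$ and $\Delta^{-1}$; the latter acts on mean-zero
  distributions and returns the mean-zero solution (at the zero frequency the formula below
  has the value 0, by the convention for division by zero).
\<close>
definition inv_one_minus_laplace :: "dist2 \<Rightarrow> dist2" where
  "inv_one_minus_laplace u = (\<lambda>\<xi>. u \<xi> / of_real (1 + freq_sq \<xi>))"

definition inv_laplace :: "dist2 \<Rightarrow> dist2" where
  "inv_laplace u = (\<lambda>\<xi>. - u \<xi> / of_real (freq_sq \<xi>))"

definition A_op :: "int \<Rightarrow> dist2 \<Rightarrow> dist2" where
  "A_op k u = (\<lambda>\<xi>. u \<xi> - (1 + (of_int k)\<^sup>2) * inv_one_minus_laplace u \<xi>)"

definition B_op :: "int \<Rightarrow> dist2 \<Rightarrow> dist2" where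
  "B_op k u = (\<lambda>\<xi>. - (1 + (of_int k)\<^sup>2) * inv_laplace u \<xi>)"

definition L_op :: "int \<Rightarrow> dist2 \<times> dist2 \<Rightarrow> dist2 \<times> dist2" where
  "L_op k = (\<lambda>(\<omega>, F).
     ((\<lambda>\<xi>. - of_int k * mult_cos k (d2 (A_op k F)) \<xi>),
      (\<lambda>\<xi>. - of_int k * mult_cos k (d2 (B_op k \<omega>)) \<xi>)))"

definition cosine_chain :: "real \<Rightarrow> int \<Rightarrow> int \<Rightarrow> (dist2 \<times> dist2) set" where
  "cosine_chain s k n =
     {(\<omega>, F) \<in> X_space s. \<exists>h f.
        h \<in> closed_span (s - 1) (\<lambda>j. fourier (\<lambda>x. cos ((2 * of_nat j + 1) * of_int k * x))) \<and>
        f \<in> closed_span s (\<lambda>j. fourier (\<lambda>x. cos (2 * of_nat j * of_int k * x))) \<and>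
        \<omega> = tensor h (fourier (\<lambda>x. sin (of_int n * x))) \<and>
        F = tensor f (fourier (\<lambda>x. cos (of_int n * x)))}"

definition chain_eigenvalue :: "real \<Rightarrow> int \<Rightarrow> int \<Rightarrow> complex \<Rightarrow> bool" where
  "chain_eigenvalue s k n l \<longleftrightarrow>
     (\<exists>(\<omega>, F) \<in> cosine_chain s k n.
        (\<omega>, F) \<noteq> ((\<lambda>_. 0), (\<lambda>_. 0)) \<and>
        L_op k (\<omega>, F) = ((\<lambda>\<xi>. l * \<omega> \<xi>), (\<lambda>\<xi>. l * F \<xi>)))"

definition lambda_kn :: "real \<Rightarrow> int \<Rightarrow> int \<Rightarrow> real" where
  "lambda_kn s k n = (THE l. 0 < l \<and> chain_eigenvalue s k n (of_real l))"

end

theory Submission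
  imports Defs "HOL-Real_Asymp.Real_Asymp"
begin

text \<open>
  The continued fractions converge because $c_j c_{j+1} \to 0$: the two-step recursion map is
  eventually a contraction, uniformly for $\mu$ bounded away from 0. The finite fractions show
  inductively that $\mu r_j(\mu)$ is nondecreasing and $r_j(\mu) / \mu$ nonincreasing, so
  $\mu G(\mu)$ is strictly increasing; since $\mu r_2(\mu) \to 0$ as $\mu \to 0$, it changes sign.

  If $G(\mu) = 0$, the products of the $r_j$ solve the recurrence and decay faster than every geometric
  sequence, whereas the defect $q_j - r_j q_{j-1}$ of any other solution grows faster than
  every geometric sequence. Hence square summability, geometric growth and membership in a
  Sobolev space of arbitrary order all select the same solutions, and the eigenvalue does not
  depend on \<open>s\<close>.
\<close>

section \<open>Fourier coefficients and closed spans of cosines\<close>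

text \<open>Three difficulties shape the argument. Odd-indexed coefficients tend to 0 but
  even-indexed ones tend to 1, so a single step of the fraction, with Lipschitz constant c_{j-1}
  c_{j+1} / \<mu>^2, need not contract for small \<mu>; the convergence, decay and growth estimates
  therefore pair two consecutive steps. The crude bound \<mu> r_2 < c_1 makes \<mu> G negative near
  0 only when c_0 + c_2 < 0. This fails for large k and n = k - 1, where c_0 is close to 0 and c_2
  close to 4/5. Hence the maximum with 0 in the final estimate, and the need for the actual limit of
  \<mu> r_2 at 0. For s < 1 the component \<omega> lies in a space of negative order, so its
  coefficients may grow, and square summability cannot be read off from membership in X^s. A
  geometric bound of arbitrary rate is weak enough to follow from either condition and still strong
  enough to exclude the growing solutions.\<close>

lemma exp_has_integral:
  fixes m :: int
  shows "((\<lambda>x. exp (\<i> * of_int m * of_real x)) has_integral (if m = 0 then of_real (2 * pi) else 0)) {0..2 * pi}"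
proof (cases "m = 0")
  case True
  have "((\<lambda>x. 1 :: complex) has_integral (2 * pi - 0) *\<^sub>R 1) {0..2 * pi}"
    using has_integral_const_real[of "1 :: complex" 0 "2 * pi"] by simp
  then show ?thesis using True by (simp add: scaleR_conv_of_real)
next
  case False
  define F where "F z = exp (\<i> * of_int m * z) / (\<i> * of_int m)" for z :: complex
  have "(F has_field_derivative exp (\<i> * of_int m * z)) (at z)" for z
    unfolding F_def using False by (auto intro!: derivative_eq_intros)
  then have "((\<lambda>x. exp (\<i> * of_int m * of_real x)) has_integral F (of_real (2 * pi)) - F (of_real 0)) {0..2 * pi}"
    by (intro fundamental_theorem_of_calculus has_vector_derivative_real_field) auto
  moreover have "exp (\<i> * of_int m * of_real (2 * pi)) = 1"
    using exp_integer_2pi[of "of_int m"] by (simp add: mult_ac)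
  ultimately show ?thesis using False by (simp add: F_def)
qed

lemma integral_exp:
  fixes m a :: int
  shows "integral {0..2 * pi} (\<lambda>x. exp (\<i> * of_int m * of_real x) * exp (- \<i> * of_int a * of_real x))
    = (if a = m then of_real (2 * pi) else 0)"
    and integrable_exp: "(\<lambda>x. exp (\<i> * of_int m * of_real x) * exp (- \<i> * of_int a * of_real x))
      integrable_on {0..2 * pi}"
proof -
  have "(\<lambda>x :: real. exp (\<i> * of_int m * of_real x) * exp (- \<i> * of_int a * of_real x))
      = (\<lambda>x. exp (\<i> * of_int (m - a) * of_real x))"
    by (simp add: algebra_simps flip: exp_add)
  with exp_has_integral[of "m - a"]
  show "integral {0..2 * pi} (\<lambda>x. exp (\<i> * of_int m * of_real x) * exp (- \<i> * of_int a * of_real x))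
      = (if a = m then of_real (2 * pi) else 0)"
    and "(\<lambda>x. exp (\<i> * of_int m * of_real x) * exp (- \<i> * of_int a * of_real x))
      integrable_on {0..2 * pi}"
    by (auto simp: has_integral_iff)
qed

lemma fourier_cos:
  fixes m a :: int
  shows "fourier (\<lambda>x. cos (of_int m * x)) a = (of_bool (a = m) + of_bool (a = - m)) / 2"
proof -
  define E where "E b x = exp (\<i> * of_int b * of_real x) * exp (- \<i> * of_int a * of_real x)"
    for b :: int and x :: real
  have E: "E b integrable_on {0..2 * pi}" for b
    unfolding E_def[abs_def] by (rule integrable_exp)
  have "complex_of_real (cos (of_int m * x)) * exp (- \<i> * of_int a * of_real x) = (E m x + E (- m) x) / 2" for x
    unfolding E_def cos_of_real[symmetric] cos_exp_eq by (simp add: field_simps)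
  then have "integral {0..2 * pi} (\<lambda>x. of_real (cos (of_int m * x)) * exp (- \<i> * of_int a * of_real x))
      = integral {0..2 * pi} (\<lambda>x. (E m x + E (- m) x) / 2)" by (simp only:)
  also have "\<dots> = (integral {0..2 * pi} (E m) + integral {0..2 * pi} (E (- m))) / 2"
    using E by (simp add: integral_add)
  also have "\<dots> = of_real (2 * pi) * ((of_bool (a = m) + of_bool (a = - m)) / 2)"
    using integral_exp[of m a] integral_exp[of "- m" a] by (simp add: E_def[abs_def])
  finally show ?thesis by (simp add: fourier_def)
qed

lemma fourier_sin:
  fixes m a :: int
  shows "fourier (\<lambda>x. sin (of_int m * x)) a = (of_bool (a = m) - of_bool (a = - m)) / (2 * \<i>)"
proof -
  define E where "E b x = exp (\<i> * of_int b * of_real x) * exp (- \<i> * of_int a * of_real x)"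
    for b :: int and x :: real
  have E: "E b integrable_on {0..2 * pi}" for b
    unfolding E_def[abs_def] by (rule integrable_exp)
  have "complex_of_real (sin (of_int m * x)) * exp (- \<i> * of_int a * of_real x) = (E m x - E (- m) x) / (2 * \<i>)" for x
    unfolding E_def sin_of_real[symmetric] sin_exp_eq by (simp add: field_simps)
  then have "integral {0..2 * pi} (\<lambda>x. of_real (sin (of_int m * x)) * exp (- \<i> * of_int a * of_real x))
      = integral {0..2 * pi} (\<lambda>x. (E m x - E (- m) x) / (2 * \<i>))" by (simp only:)
  also have "\<dots> = (integral {0..2 * pi} (E m) - integral {0..2 * pi} (E (- m))) / (2 * \<i>)"
    using E by (simp add: integral_diff)
  also have "\<dots> = of_real (2 * pi) * ((of_bool (a = m) - of_bool (a = - m)) / (2 * \<i>))"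
    using integral_exp[of m a] integral_exp[of "- m" a] by (simp add: E_def[abs_def])
  finally show ?thesis by (simp add: fourier_def)
qed

section \<open>Weighted norms and closed spans on the circle\<close>

abbreviation weight :: "real \<Rightarrow> int \<Rightarrow> real" where
  "weight s a \<equiv> (1 + (of_int a)\<^sup>2) powr s"

lemma weight_base_ge_1: "1 \<le> 1 + (of_int a :: real)\<^sup>2"
  by simp

lemma weight_pos: "0 < weight s a"
  using weight_base_ge_1[of a] by (simp only: powr_gt_zero)

text \<open>For a non-summable family the infinite sum is 0 by default, so
  \<open>sobolev1_norm\<close> carries information about a difference only once the difference is
  known to lie in the space.\<close>

lemma sobolev1_diff_finite:
  assumes "f \<in> sobolev1 s" "finite {a. h a \<noteq> 0}"
  shows "(\<lambda>a. f a - h a) \<in> sobolev1 s"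
proof -
  let ?F = "{a. h a \<noteq> 0}"
  have "(\<lambda>a. weight s a * (cmod (f a))\<^sup>2) summable_on (UNIV - ?F)"
    using assms by (intro summable_on_cofin_subset) (auto simp: sobolev1_def)
  then have "(\<lambda>a. weight s a * (cmod (f a - h a))\<^sup>2) summable_on (UNIV - ?F)"
    by (rule summable_on_cong[THEN iffD1, rotated]) auto
  then have "(\<lambda>a. weight s a * (cmod (f a - h a))\<^sup>2) summable_on ((UNIV - ?F) \<union> ?F)"
    by (rule summable_on_union[OF _ summable_on_finite[OF assms(2)]])
  then show ?thesis by (simp add: sobolev1_def Un_absorb2)
qed

lemma weight_mult_le_sobolev1_norm:
  assumes "f \<in> sobolev1 s"
  shows "weight (s / 2) a * cmod (f a) \<le> sobolev1_norm s f"
proof -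
  have "weight s a * (cmod (f a))\<^sup>2 \<le> (\<Sum>\<^sub>\<infinity>a. weight s a * (cmod (f a))\<^sup>2)"
    using finite_sum_le_infsum[of "\<lambda>a. weight s a * (cmod (f a))\<^sup>2" UNIV "{a}"] assms
    by (simp add: sobolev1_def)
  moreover have "(weight (s / 2) a * cmod (f a))\<^sup>2 = weight s a * (cmod (f a))\<^sup>2"
    using weight_base_ge_1[of a] by (simp add: power_mult_distrib power2_eq_square[of "_ powr _"] flip: powr_add)
  ultimately show ?thesis unfolding sobolev1_norm_def by (intro real_le_rsqrt) simp
qed

text \<open>Evaluation of a single coefficient is continuous in the norm of order s, so a linear
  relation between two coefficients that holds for all generators survives the closure. It is used
  with z = 1 for evenness and z = 0 for the support.\<close>

lemma closed_span_linear_relation: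
  assumes f: "f \<in> closed_span s e" and fin: "\<And>j. finite {a. e j a \<noteq> 0}"
    and rel: "\<And>j. e j a = z * e j b"
  shows "f a = z * f b"
proof -
  \<comment> \<open>K bounds the norm of the functional sending f to
    \<open>f a - z * f b\<close>.\<close>
  define K where "K = 1 / weight (s / 2) a + cmod z / weight (s / 2) b"
  have K: "0 < K" unfolding K_def using weight_pos by (intro add_pos_nonneg) auto
  have "cmod (f a - z * f b) \<le> \<epsilon>" if "0 < \<epsilon>" for \<epsilon>
  proof -
    obtain N \<alpha> where N: "sobolev1_norm s (\<lambda>a. f a - (\<Sum>j<N. \<alpha> j * e j a)) < \<epsilon> / K"
      using f divide_pos_pos[OF \<open>0 < \<epsilon>\<close> K] unfolding closed_span_def by blast
    define g where "g a = f a - (\<Sum>j<N. \<alpha> j * e j a)" for a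
    have "{a. (\<Sum>j<N. \<alpha> j * e j a) \<noteq> 0} \<subseteq> (\<Union>j<N. {a. e j a \<noteq> 0})"
    proof
      fix a
      assume "a \<in> {a. (\<Sum>j<N. \<alpha> j * e j a) \<noteq> 0}"
      then obtain j where "j < N" "\<alpha> j * e j a \<noteq> 0"
        by (auto elim: sum.not_neutral_contains_not_neutral)
      then show "a \<in> (\<Union>j<N. {a. e j a \<noteq> 0})" by auto
    qed
    then have "g \<in> sobolev1 s"
      unfolding g_def using f fin
      by (intro sobolev1_diff_finite) (auto simp: closed_span_def intro: finite_subset)
    then have g: "cmod (g c) \<le> (\<epsilon> / K) / weight (s / 2) c" for c
      unfolding pos_le_divide_eq[OF weight_pos]
      using weight_mult_le_sobolev1_norm[of g s c] N by (simp add: g_def[abs_def] mult.commute)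
    have "f a - z * f b = g a - z * g b"
      by (simp add: g_def rel algebra_simps sum_distrib_left)
    then have "cmod (f a - z * f b) \<le> cmod (g a) + cmod z * cmod (g b)"
      using norm_triangle_ineq4[of "g a" "z * g b"] by (simp add: norm_mult)
    also have "\<dots> \<le> (\<epsilon> / K) / weight (s / 2) a + cmod z * ((\<epsilon> / K) / weight (s / 2) b)"
      by (intro add_mono mult_left_mono g) auto
    also have "\<dots> = (\<epsilon> / K) * K"
      unfolding K_def distrib_left by simp
    finally show ?thesis using K by simp
  qed
  then have "cmod (f a - z * f b) \<le> 0" by (rule field_le_epsilon) simp
  then show ?thesis by simp
qed

text \<open>If an approximant either reproduces f or vanishes at each frequency, the error is a part
  of f supported off F, and its norm is bounded by a tail of the convergent weighted sum.\<close>

lemma closed_span_truncations: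
  assumes f: "f \<in> sobolev1 s"
    and trunc: "\<And>F. finite F \<Longrightarrow> \<exists>N \<alpha>. (\<forall>a. (\<Sum>j<N. \<alpha> j * e j a) \<in> {0, f a}) \<and> (\<forall>a\<in>F. (\<Sum>j<N. \<alpha> j * e j a) = f a)"
  shows "f \<in> closed_span s e"
  unfolding closed_span_def
proof (intro CollectI conjI f allI impI)
  fix \<epsilon> :: real
  assume "0 < \<epsilon>"
  let ?w = "\<lambda>a. weight s a * (cmod (f a))\<^sup>2"
  have sum: "?w summable_on UNIV" using f by (simp add: sobolev1_def)
  have "\<forall>\<^sub>F F in finite_subsets_at_top UNIV. dist (sum ?w F) (infsum ?w UNIV) < \<epsilon>\<^sup>2"
    using infsum_tendsto[OF sum] \<open>0 < \<epsilon>\<close> by (intro tendstoD) auto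
  then obtain F where F: "finite F" "dist (sum ?w F) (infsum ?w UNIV) < \<epsilon>\<^sup>2"
    unfolding eventually_finite_subsets_at_top by blast
  obtain N \<alpha> where N: "\<And>a. (\<Sum>j<N. \<alpha> j * e j a) \<in> {0, f a}" "\<And>a. a \<in> F \<Longrightarrow> (\<Sum>j<N. \<alpha> j * e j a) = f a"
    using trunc[OF F(1)] by blast
  define g where "g a = f a - (\<Sum>j<N. \<alpha> j * e j a)" for a
  have tail: "?w summable_on (UNIV - F)" using sum F(1) by (rule summable_on_cofin_subset)
  have g: "g a = 0 \<or> g a = f a" "a \<in> F \<Longrightarrow> g a = 0" for a using N[of a] by (auto simp: g_def)
  have le: "weight s a * (cmod (g a))\<^sup>2 \<le> ?w a" for a using g(1)[of a] by auto
  have gsum: "(\<lambda>a. weight s a * (cmod (g a))\<^sup>2) summable_on UNIV"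
    using sum le by (rule summable_on_comparison_test) auto
  have "(\<Sum>\<^sub>\<infinity>a. weight s a * (cmod (g a))\<^sup>2) \<le> infsum ?w (UNIV - F)"
    using gsum tail by (rule infsum_mono_neutral) (use le g in auto)
  also have "\<dots> = infsum ?w UNIV - sum ?w F"
    using infsum_Diff[OF sum summable_on_finite[OF F(1)]] F(1) by simp
  also have "\<dots> < \<epsilon>\<^sup>2" using F(2) by (simp add: dist_real_def abs_less_iff)
  finally have "sobolev1_norm s g < \<epsilon>"
    unfolding sobolev1_norm_def using \<open>0 < \<epsilon>\<close> by (intro real_less_lsqrt) auto
  then show "\<exists>N \<alpha>. sobolev1_norm s (\<lambda>a. f a - (\<Sum>j<N. \<alpha> j * e j a)) < \<epsilon>"
    unfolding g_def[abs_def] by blast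
qed

text \<open>Evenness and the support condition pass to the closure as relations between
  coefficients. Conversely, distinct nonnegative \<open>m j\<close> have disjoint frequency sets {m
  j, - m j}, so partial sums are truncations of f.\<close>

lemma closed_span_cos_iff:
  fixes m :: "nat \<Rightarrow> int"
  assumes "inj m" and nonneg: "\<And>j. 0 \<le> m j"
  shows "f \<in> closed_span s (\<lambda>j. fourier (\<lambda>x. cos (of_int (m j) * x)))
    \<longleftrightarrow> f \<in> sobolev1 s \<and> (\<forall>a. f (- a) = f a) \<and> (\<forall>a. f a \<noteq> 0 \<longrightarrow> (\<exists>j. \<bar>a\<bar> = m j))"
    (is "f \<in> closed_span s ?e \<longleftrightarrow> ?R")
proof
  assume f: "f \<in> closed_span s ?e"
  have fin: "finite {a. ?e j a \<noteq> 0}" for j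
    by (rule finite_subset[of _ "{m j, - m j}"]) (auto simp: fourier_cos split: if_splits)
  have "f (- a) = 1 * f a" for a
    by (rule closed_span_linear_relation[OF f fin]) (auto simp: fourier_cos of_bool_def)
  moreover have "\<exists>j. \<bar>a\<bar> = m j" if "f a \<noteq> 0" for a
  proof (rule ccontr)
    assume "\<nexists>j. \<bar>a\<bar> = m j"
    then have "?e j a = 0 * ?e j a" for j using nonneg[of j] by (auto simp: fourier_cos)
    then have "f a = 0 * f a" by (rule closed_span_linear_relation[OF f fin])
    with that show False by simp
  qed
  ultimately show ?R using f by (auto simp: closed_span_def)
next
  assume R: ?R
  show "f \<in> closed_span s ?e"
  proof (rule closed_span_truncations)
    fix F :: "int set"
    assume "finite F"
    \<comment> \<open>Dividing by the coefficient of the generator treats \<open>m j = 0\<close>,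
      where it is 1, together with the other frequencies, where it is 1/2.\<close>
    define \<alpha> where "\<alpha> j = f (m j) / ?e j (m j)" for j
    have e: "?e j a = (if \<bar>a\<bar> = m j then ?e j (m j) else 0)" for j a
      using nonneg[of j] by (auto simp: fourier_cos abs_if split: if_splits)
    have e_nz: "?e j (m j) \<noteq> 0" for j by (auto simp: fourier_cos of_bool_def)
    have entry: "\<alpha> j * ?e j a = (if \<bar>a\<bar> = m j then f a else 0)" for j a
    proof (cases "\<bar>a\<bar> = m j")
      case True
      have "f a = f \<bar>a\<bar>" using R by (simp add: abs_if)
      then have "f a = f (m j)" using True by simp
      then show ?thesis using e[of j a] e_nz[of j] True by (simp add: \<alpha>_def)
    qed (simp add: e[of j a])
    have part: "(\<Sum>j<N. \<alpha> j * ?e j a) = (if \<exists>j<N. \<bar>a\<bar> = m j then f a else 0)" for N a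
    proof (cases "\<exists>j<N. \<bar>a\<bar> = m j")
      case True
      then obtain i where i: "i < N" "\<bar>a\<bar> = m i" by blast
      have "(\<Sum>j<N. \<alpha> j * ?e j a) = (\<Sum>j<N. if j = i then f a else 0)"
        using i \<open>inj m\<close> unfolding entry by (intro sum.cong) (auto dest: injD)
      then show ?thesis using i by auto
    qed (auto simp: entry intro!: sum.neutral)
    obtain N where "\<And>a. a \<in> F \<Longrightarrow> f a \<noteq> 0 \<Longrightarrow> \<exists>j<N. \<bar>a\<bar> = m j"
    proof -
      obtain idx where "\<forall>a. f a \<noteq> 0 \<longrightarrow> \<bar>a\<bar> = m (idx a)"
        using R choice[of "\<lambda>a j. f a \<noteq> 0 \<longrightarrow> \<bar>a\<bar> = m j"] by auto
      moreover obtain N where "\<forall>i\<in>idx ` F. i < N"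
        using \<open>finite F\<close> finite_nat_set_iff_bounded by blast
      ultimately show ?thesis by (intro that[of N]) blast
    qed
    then show "\<exists>N \<alpha>. (\<forall>a. (\<Sum>j<N. \<alpha> j * ?e j a) \<in> {0, f a}) \<and> (\<forall>a\<in>F. (\<Sum>j<N. \<alpha> j * ?e j a) = f a)"
      by (intro exI[of _ N] exI[of _ \<alpha>]) (auto simp: part)
  qed (use R in simp)
qed

text \<open>Only finitely many rows b contribute, and in each row the planar weight is at most a
  constant times the weight in a: for s >= 0 because 1 + a^2 + b^2 <= (1 + a^2)(1 + b^2), for s < 0
  because the power is decreasing.\<close>

lemma sobolev2_tensor:
  assumes f: "f \<in> sobolev1 s" and g: "finite {b. g b \<noteq> 0}"
  shows "tensor f g \<in> sobolev2 s"
proof -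
  let ?S = "{b. g b \<noteq> 0}"
  let ?w = "\<lambda>\<xi>. (1 + freq_sq \<xi>) powr s * (cmod (tensor f g \<xi>))\<^sup>2"
  have w_le: "(1 + freq_sq (a, b)) powr s \<le> (1 + (of_int b)\<^sup>2) powr \<bar>s\<bar> * weight s a" for a b
  proof (cases "0 \<le> s")
    case True
    have "1 + freq_sq (a, b) \<le> (1 + (of_int b)\<^sup>2) * (1 + (of_int a)\<^sup>2)"
      by (simp add: freq_sq_def algebra_simps)
    then have "(1 + freq_sq (a, b)) powr s \<le> ((1 + (of_int b)\<^sup>2) * (1 + (of_int a)\<^sup>2)) powr s"
      using True by (intro powr_mono2) (auto simp: freq_sq_def)
    then show ?thesis using True by (simp add: powr_mult)
  next
    case False
    have "(1 + freq_sq (a, b)) powr s \<le> 1 * weight s a"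
      using False weight_base_ge_1[of a] by (simp, intro powr_mono2') (auto simp: freq_sq_def intro: add_pos_nonneg)
    also have "\<dots> \<le> (1 + (of_int b)\<^sup>2) powr \<bar>s\<bar> * weight s a"
      by (intro mult_right_mono ge_one_powr_ge_zero) auto
    finally show ?thesis .
  qed
  have row: "?w summable_on (UNIV \<times> {b})" for b
  proof -
    have "(\<lambda>a. weight s a * (cmod (f a))\<^sup>2) summable_on UNIV" using f by (simp add: sobolev1_def)
    then have "(\<lambda>a. ((1 + (of_int b)\<^sup>2) powr \<bar>s\<bar> * (cmod (g b))\<^sup>2) * (weight s a * (cmod (f a))\<^sup>2)) summable_on UNIV"
      by (rule summable_on_cmult_right)
    then have "(\<lambda>a. ?w (a, b)) summable_on UNIV"
    proof (rule summable_on_comparison_test)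
      fix a
      have "?w (a, b) \<le> ((1 + (of_int b)\<^sup>2) powr \<bar>s\<bar> * weight s a) * ((cmod (f a))\<^sup>2 * (cmod (g b))\<^sup>2)"
        using w_le by (intro mult_mono) (auto simp: tensor_def norm_mult power_mult_distrib)
      then show "?w (a, b) \<le> ((1 + (of_int b)\<^sup>2) powr \<bar>s\<bar> * (cmod (g b))\<^sup>2) * (weight s a * (cmod (f a))\<^sup>2)"
        by (simp add: mult_ac)
    qed simp
    then have "?w summable_on (\<lambda>a. (a, b)) ` UNIV"
      by (subst summable_on_reindex) (auto simp: inj_on_def o_def)
    moreover have "UNIV \<times> {b} = (\<lambda>a :: int. (a, b)) ` UNIV" by auto
    ultimately show ?thesis by (simp only:)
  qed
  have "?w summable_on (\<Union>b\<in>?S. UNIV \<times> {b})"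
    using g row by (rule summable_on_finite_union_disjoint) auto
  then have "?w summable_on UNIV"
    by (rule summable_on_cong_neutral[THEN iffD1, rotated -1]) (auto simp: tensor_def)
  then show ?thesis by (simp add: sobolev2_def)
qed

section \<open>Sobolev membership compared with geometric bounds\<close>

lemma ex_weight_le_two_power:
  obtains D where "0 < D" "\<And>a. weight s a \<le> D * 2 ^ nat \<bar>a\<bar>"
proof -
  have "(\<lambda>m :: nat. (1 + (real m)\<^sup>2) powr s / 2 ^ m) \<longlonglongrightarrow> 0" by real_asymp
  then have "Bseq (\<lambda>m :: nat. (1 + (real m)\<^sup>2) powr s / 2 ^ m)"
    by (intro convergent_imp_Bseq convergentI)
  then obtain D where D: "0 < D" "\<forall>m :: nat. norm ((1 + (real m)\<^sup>2) powr s / 2 ^ m) \<le> D"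
    by (rule BseqE)
  have "weight s a \<le> D * 2 ^ nat \<bar>a\<bar>" for a
    using spec[OF D(2), of "nat \<bar>a\<bar>"] by (simp add: pos_divide_le_eq)
  with D(1) show ?thesis by (rule that)
qed

lemma half_power_abs_summable: "(\<lambda>a :: int. (1 / 2 :: real) ^ nat \<bar>a\<bar>) summable_on UNIV"
proof -
  have "(\<lambda>m. (1 / 2 :: real) ^ m) summable_on UNIV"
    by (intro norm_summable_imp_summable_on) (simp add: summable_geometric)
  then have "(\<lambda>a :: int. (1 / 2 :: real) ^ nat \<bar>a\<bar>) summable_on (range int \<union> range (\<lambda>m. - int m))"
    by (intro summable_on_union) (simp_all add: summable_on_reindex inj_on_def o_def)
  moreover have "range int \<union> range (\<lambda>m. - int m) = UNIV"
    by (auto simp: image_iff, metis int_cases2)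
  ultimately show ?thesis by simp
qed

text \<open>Squaring gives decay at rate 1/4; the weight costs at most a factor 2 per frequency,
  which leaves a summable factor 1/2.\<close>

lemma sobolev1_exp_decay:
  assumes "\<And>a. cmod (f a) \<le> C * (1 / 2) ^ nat \<bar>a\<bar>"
  shows "f \<in> sobolev1 s"
proof -
  obtain D where D: "0 < D" "\<And>a. weight s a \<le> D * 2 ^ nat \<bar>a\<bar>"
    using ex_weight_le_two_power[where s = s] by blast
  have le: "weight s a * (cmod (f a))\<^sup>2 \<le> (D * C\<^sup>2) * (1 / 2) ^ nat \<bar>a\<bar>" for a
  proof -
    have "weight s a * (cmod (f a))\<^sup>2 \<le> (D * 2 ^ nat \<bar>a\<bar>) * (C * (1 / 2) ^ nat \<bar>a\<bar>)\<^sup>2"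
      using D assms by (intro mult_mono power_mono) auto
    also have "\<dots> = (D * C\<^sup>2) * ((2 * (1 / 2)) ^ nat \<bar>a\<bar> * (1 / 2) ^ nat \<bar>a\<bar>)"
      by (simp only: power_mult_distrib power2_eq_square mult_ac)
    finally show ?thesis by simp
  qed
  have "(\<lambda>a :: int. (D * C\<^sup>2) * (1 / 2) ^ nat \<bar>a\<bar>) summable_on UNIV"
    using half_power_abs_summable by (rule summable_on_cmult_right)
  then have "(\<lambda>a. weight s a * (cmod (f a))\<^sup>2) summable_on UNIV"
    using le by (rule summable_on_comparison_test) auto
  then show ?thesis by (simp add: sobolev1_def)
qed

text \<open>Each coefficient is at most the norm divided by a weight of order s / 2. The inverse
  weight may grow when s is negative, but only polynomially, and the generous base 2 covers every
  s.\<close>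

lemma sobolev1_exp_growth:
  assumes "f \<in> sobolev1 s"
  obtains C where "\<And>a. cmod (f a) \<le> C * 2 ^ nat \<bar>a\<bar>"
proof -
  obtain D where D: "0 < D" "\<And>a. weight (- (s / 2)) a \<le> D * 2 ^ nat \<bar>a\<bar>"
    using ex_weight_le_two_power[where s = "- (s / 2)"] by blast
  have "cmod (f a) \<le> (sobolev1_norm s f * D) * 2 ^ nat \<bar>a\<bar>" for a
  proof -
    have n: "0 \<le> sobolev1_norm s f"
      by (rule order.trans[OF _ weight_mult_le_sobolev1_norm[OF assms, of a]]) simp
    have "cmod (f a) \<le> sobolev1_norm s f / weight (s / 2) a"
      unfolding pos_le_divide_eq[OF weight_pos]
      using weight_mult_le_sobolev1_norm[OF assms, of a] by (simp only: mult.commute)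
    also have "\<dots> = sobolev1_norm s f * weight (- (s / 2)) a" by (simp add: powr_minus_divide)
    also have "\<dots> \<le> sobolev1_norm s f * (D * 2 ^ nat \<bar>a\<bar>)" using D n by (intro mult_left_mono)
    finally show ?thesis by simp
  qed
  then show ?thesis by (rule that)
qed

section \<open>The continued fractions\<close>

locale chain =
  fixes k n :: int
  assumes n_pos: "1 \<le> n" and n_less_k: "n < k"
begin

abbreviation "c \<equiv> coef k n"
abbreviation "t \<mu> \<equiv> fin_cf k n \<mu>"
abbreviation "r \<equiv> cf k n"

section \<open>Signs and decay of the coefficients\<close>

lemma n_sq_pos: "0 < (of_int n :: real)\<^sup>2"
  using n_pos by simp

lemma n_sq_less_k_sq: "(of_int n :: real)\<^sup>2 < (of_int k)\<^sup>2"
  using n_pos n_less_k by (intro power_strict_mono) auto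

lemma one_le_k_sq: "1 \<le> (of_int k :: real)\<^sup>2"
  using n_pos n_less_k by (simp add: one_le_power)

lemma coef_0_neg: "c 0 < 0"
proof -
  have "2 * ((of_int n :: real)\<^sup>2 - (of_int k)\<^sup>2) < 0"
    using n_sq_less_k_sq by (intro mult_pos_neg) auto
  moreover have "0 < (of_int n :: real)\<^sup>2 + 1" using n_sq_pos by linarith
  ultimately show ?thesis unfolding coef_def by (simp only: if_True divide_neg_pos refl)
qed

lemma coef_pos:
  assumes "0 < j"
  shows "0 < c j"
proof -
  have "(of_int k :: real)\<^sup>2 * 1 \<le> (of_int k)\<^sup>2 * (real j)\<^sup>2"
    using assms by (intro mult_left_mono) auto
  then have "0 < (of_nat j :: real)\<^sup>2 * (of_int k)\<^sup>2 + (of_int n)\<^sup>2 - (of_int k)\<^sup>2"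
    using n_sq_pos by (simp only: mult.commute[of "(real j)\<^sup>2"])
  moreover have "0 < (of_nat j :: real)\<^sup>2 * (of_int k)\<^sup>2 + (of_int n)\<^sup>2"
    using n_sq_pos by (intro add_nonneg_pos) auto
  moreover have "0 < 1 + (of_int k :: real)\<^sup>2" using one_le_k_sq by linarith
  ultimately show ?thesis
    using assms unfolding coef_def by (auto intro!: divide_pos_pos)
qed

lemma coef_pred_pos: "2 \<le> j \<Longrightarrow> 0 < c (j - 1)"
  by (rule coef_pos) simp

lemma coef_even_le:
  assumes "1 \<le> j" "even j"
  shows "c j \<le> 1"
proof -
  have "0 < (of_nat j :: real)\<^sup>2 * (of_int k)\<^sup>2 + (of_int n)\<^sup>2 + 1"
    by (intro add_nonneg_pos) auto
  then show ?thesis using assms one_le_k_sq unfolding coef_def by (simp add: divide_simps)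
qed

lemma coef_odd_le:
  assumes "odd j"
  shows "c j \<le> 2 / (real j)\<^sup>2"
proof -
  have j: "0 < (real j)\<^sup>2" using assms by (auto elim: oddE)
  have "(1 + (of_int k)\<^sup>2) / ((real j)\<^sup>2 * (of_int k)\<^sup>2 + (of_int n)\<^sup>2)
      \<le> (2 * (of_int k)\<^sup>2) / ((real j)\<^sup>2 * (of_int k)\<^sup>2)"
  proof (rule frac_le)
    show "0 < (real j)\<^sup>2 * (of_int k)\<^sup>2" using one_le_k_sq j by (intro mult_pos_pos) linarith+
  qed (use one_le_k_sq n_pos n_less_k in auto)
  also have "\<dots> = 2 / (real j)\<^sup>2" using n_pos n_less_k by simp
  finally show ?thesis using assms unfolding coef_def by (auto split: if_splits)
qed

lemma coef_le_2:
  assumes "1 \<le> j"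
  shows "c j \<le> 2"
proof (cases "even j")
  case True
  then show ?thesis using coef_even_le[OF assms] by simp
next
  case False
  have "1 \<le> (real j)\<^sup>2" using assms by (simp add: one_le_power)
  then have "2 / (real j)\<^sup>2 \<le> 2" by (simp add: divide_le_eq)
  then show ?thesis using coef_odd_le[OF False] by linarith
qed

text \<open>Of two consecutive indices one is even, with coefficient at most 1, and the other odd,
  with coefficient of order 1 / j^2.\<close>

lemma coef_mult_Suc_le:
  assumes "1 \<le> j"
  shows "c j * c (Suc j) \<le> 2 / (real j)\<^sup>2"
proof (cases "even j")
  case True
  have "c j * c (Suc j) \<le> 1 * c (Suc j)"
    using coef_even_le[OF assms True] coef_pos[of "Suc j"] by (intro mult_right_mono) auto
  also have "\<dots> \<le> 2 / (real (Suc j))\<^sup>2" using coef_odd_le[of "Suc j"] True by simp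
  also have "\<dots> \<le> 2 / (real j)\<^sup>2" using assms by (intro divide_left_mono) auto
  finally show ?thesis .
next
  case False
  have "c j * c (Suc j) \<le> c j * 1"
    using coef_even_le[of "Suc j"] coef_pos[of j] assms False by (intro mult_left_mono) auto
  then show ?thesis using coef_odd_le[OF False] by simp
qed

lemma coef_mult_Suc_tendsto_0: "(\<lambda>j. c j * c (Suc j)) \<longlonglongrightarrow> 0"
proof (rule tendsto_sandwich[of "\<lambda>_. 0" _ _ "\<lambda>j. 2 / (real j)\<^sup>2"])
  show "\<forall>\<^sub>F j in sequentially. 0 \<le> c j * c (Suc j)"
    using eventually_ge_at_top[of 1]
    by eventually_elim (auto intro!: mult_nonneg_nonneg less_imp_le[OF coef_pos])
  show "\<forall>\<^sub>F j in sequentially. c j * c (Suc j) \<le> 2 / (real j)\<^sup>2"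
    using eventually_ge_at_top[of 1] by eventually_elim (rule coef_mult_Suc_le)
  show "(\<lambda>j. 2 / (real j)\<^sup>2) \<longlonglongrightarrow> 0" by real_asymp
qed simp

lemma ex_coef_mult_Suc_small:
  assumes "0 < e"
  obtains J where "1 \<le> J" "\<And>j. J \<le> j \<Longrightarrow> c j * c (Suc j) \<le> e"
proof -
  from order_tendstoD(2)[OF coef_mult_Suc_tendsto_0 assms]
  obtain J where J: "\<And>j. J \<le> j \<Longrightarrow> c j * c (Suc j) < e" by (auto simp: eventually_at_top_linorder)
  show ?thesis by (rule that[of "max 1 J"]) (auto intro: less_imp_le J)
qed

section \<open>Finite fractions and their locally uniform limits\<close>

lemma fin_cf_rec: "j \<le> N \<Longrightarrow> t \<mu> N j = c (j - 1) / (\<mu> + c (Suc j) * t \<mu> N (Suc j))"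
  by (subst fin_cf.simps) simp

lemma fin_cf_beyond: "N < j \<Longrightarrow> t \<mu> N j = 0"
  by (subst fin_cf.simps) simp

text \<open>Downward induction from the last index N. Starting at index 2 keeps the numerators away
  from \<open>c 0\<close>, the only negative coefficient.\<close>

lemma fin_cf_nonneg:
  assumes "0 < \<mu>" "2 \<le> j"
  shows "0 \<le> t \<mu> N j"
proof (cases "j \<le> N")
  case True
  then show ?thesis using assms(2)
  proof (induction j rule: inc_induct)
    case base
    then show ?case using coef_pred_pos[of N] assms
      by (auto simp: fin_cf_rec fin_cf_beyond intro!: divide_nonneg_nonneg)
  next
    case (step j)
    then have "0 \<le> c (Suc j) * t \<mu> N (Suc j)"
      using coef_pos[of "Suc j"] by (intro mult_nonneg_nonneg) auto
    then show ?case using step coef_pred_pos[of j] assms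
      by (subst fin_cf_rec) (auto intro!: divide_nonneg_nonneg)
  qed
qed (simp add: fin_cf_beyond)

lemma cf_denom_ge:
  assumes "0 < \<mu>" "2 \<le> j"
  shows "\<mu> \<le> \<mu> + c (Suc j) * t \<mu> N (Suc j)"
  using fin_cf_nonneg[of \<mu> "Suc j" N] coef_pos[of "Suc j"] assms by simp

lemma fin_cf_le:
  assumes "0 < \<mu>" "2 \<le> j"
  shows "t \<mu> N j \<le> c (j - 1) / \<mu>"
proof (cases "j \<le> N")
  case True
  have "0 \<le> c (Suc j) * t \<mu> N (Suc j)"
    using fin_cf_nonneg[of \<mu> "Suc j" N] coef_pos[of "Suc j"] assms by simp
  then show ?thesis using True assms coef_pred_pos[of j]
    by (subst fin_cf_rec) (auto intro!: divide_left_mono mult_pos_pos add_pos_nonneg)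
next
  case False
  then show ?thesis using assms coef_pred_pos[of j] by (simp add: fin_cf_beyond)
qed

text \<open>The factor is the Lipschitz constant on [0, \<infinity>) of the map sending x to c_{j-1}
  / (\<mu> + c_{j+1} x).\<close>

lemma fin_cf_diff_le:
  assumes "0 < \<mu>" "2 \<le> j" "j \<le> N" "j \<le> N'"
  shows "\<bar>t \<mu> N j - t \<mu> N' j\<bar>
    \<le> c (j - 1) * c (Suc j) / \<mu>\<^sup>2 * \<bar>t \<mu> N (Suc j) - t \<mu> N' (Suc j)\<bar>"
proof -
  define a where "a = t \<mu> N (Suc j)"
  define b where "b = t \<mu> N' (Suc j)"
  define p where "p = \<mu> + c (Suc j) * a"
  define p' where "p' = \<mu> + c (Suc j) * b"
  have p: "\<mu> \<le> p" "\<mu> \<le> p'" using cf_denom_ge assms unfolding p_def p'_def a_def b_def by auto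
  then have "\<mu>\<^sup>2 \<le> p * p'" "0 < p * p'"
    using assms unfolding power2_eq_square by (auto intro!: mult_mono mult_pos_pos)
  have "t \<mu> N j - t \<mu> N' j = c (j - 1) / p - c (j - 1) / p'"
    using assms by (simp add: fin_cf_rec p_def p'_def a_def b_def)
  also have "\<dots> = c (j - 1) * c (Suc j) * (b - a) / (p * p')"
    using p assms(1) by (simp add: field_simps) (simp add: p_def p'_def field_simps)
  finally have "\<bar>t \<mu> N j - t \<mu> N' j\<bar> = c (j - 1) * c (Suc j) * \<bar>a - b\<bar> / (p * p')"
    using \<open>0 < p * p'\<close> coef_pred_pos[of j] coef_pos[of "Suc j"] assms
    by (simp only: abs_divide abs_mult[of "c (j - 1) * c (Suc j)"] abs_minus_commute[of a b] abs_of_pos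
        mult_pos_pos)
  also have "\<dots> \<le> c (j - 1) * c (Suc j) * \<bar>a - b\<bar> / \<mu>\<^sup>2"
    using \<open>0 < p * p'\<close> \<open>\<mu>\<^sup>2 \<le> p * p'\<close> coef_pred_pos[of j] coef_pos[of "Suc j"] assms
    by (intro divide_left_mono) auto
  finally show ?thesis unfolding a_def b_def by simp
qed

text \<open>In one step the two coefficients have indices of equal parity and may both be close to
  1. Two steps involve four consecutive indices, which regroup into two products of neighbours, each
  at most \<delta>^2 / 2; the gain is 1/4 per double step. The initial factor 2 / \<delta> bounds
  any single fraction.\<close>

lemma fin_cf_diff_le_geometric:
  assumes J: "\<And>j. J \<le> j \<Longrightarrow> c j * c (Suc j) \<le> \<delta>\<^sup>2 / 2" and "0 < \<delta>" "\<delta> \<le> \<mu>"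
  shows "2 \<le> j \<Longrightarrow> J < j \<Longrightarrow> j + 2 * i \<le> N \<Longrightarrow> j + 2 * i \<le> N' \<Longrightarrow>
    \<bar>t \<mu> N j - t \<mu> N' j\<bar> \<le> (1 / 4) ^ i * (2 / \<delta>)"
proof (induction i arbitrary: j)
  case 0
  have "c (j - 1) / \<mu> \<le> 2 / \<delta>"
    using coef_le_2[of "j - 1"] 0 assms by (intro frac_le) auto
  then show ?case
    using fin_cf_nonneg[of \<mu> j N] fin_cf_nonneg[of \<mu> j N'] fin_cf_le[of \<mu> j N] fin_cf_le[of \<mu> j N'] 0 assms
    by (simp add: abs_le_iff)
next
  case (Suc i)
  have \<mu>: "0 < \<mu>" using assms by simp
  have sq: "0 < \<delta>\<^sup>2" "\<delta>\<^sup>2 \<le> \<mu>\<^sup>2" using assms by (auto intro: power_mono)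
  have half: "x / \<mu>\<^sup>2 \<le> 1 / 2" if "x \<le> \<delta>\<^sup>2 / 2" for x
    using that sq by (simp add: divide_le_eq)
  have pos: "0 < c (j - 1)" "0 < c j" "0 < c (Suc j)" "0 < c (Suc (Suc j))"
    using Suc.prems coef_pos by auto
  define D where "D = \<bar>t \<mu> N (Suc (Suc j)) - t \<mu> N' (Suc (Suc j))\<bar>"
  have "\<bar>t \<mu> N j - t \<mu> N' j\<bar>
      \<le> c (j - 1) * c (Suc j) / \<mu>\<^sup>2 * \<bar>t \<mu> N (Suc j) - t \<mu> N' (Suc j)\<bar>"
    using Suc.prems \<mu> by (intro fin_cf_diff_le) auto
  also have "\<dots> \<le> c (j - 1) * c (Suc j) / \<mu>\<^sup>2 * (c j * c (Suc (Suc j)) / \<mu>\<^sup>2 * D)"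
    using Suc.prems \<mu> pos fin_cf_diff_le[of \<mu> "Suc j" N N'] unfolding D_def
    by (intro mult_left_mono) auto
  \<comment> \<open>The regrouping that replaces products of equal parity by products of
    neighbours.\<close>
  also have "\<dots> = (c (j - 1) * c j / \<mu>\<^sup>2) * (c (Suc j) * c (Suc (Suc j)) / \<mu>\<^sup>2) * D"
    by (simp add: field_simps)
  also have "\<dots> \<le> (1 / 2) * (1 / 2) * D"
    using J[of "j - 1"] J[of "Suc j"] Suc.prems pos
    by (intro mult_mono half) (auto simp: D_def)
  also have "\<dots> \<le> (1 / 2) * (1 / 2) * ((1 / 4) ^ i * (2 / \<delta>))"
    unfolding D_def using Suc.prems by (intro mult_left_mono Suc.IH) auto
  finally show ?case by simp
qed

lemma uniformly_Cauchy_fin_cf_large: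
  assumes J: "\<And>j. J \<le> j \<Longrightarrow> c j * c (Suc j) \<le> \<delta>\<^sup>2 / 2" and "0 < \<delta>" "2 \<le> j" "J < j"
  shows "uniformly_Cauchy_on {\<delta>..} (\<lambda>N \<mu>. t \<mu> N j)"
proof (rule uniformly_Cauchy_onI)
  fix e :: real
  assume "0 < e"
  then obtain i where "(1 / 4) ^ i < e / (2 / \<delta>)"
    using real_arch_pow_inv[of "e / (2 / \<delta>)" "1 / 4"] \<open>0 < \<delta>\<close> by auto
  then have i: "(1 / 4) ^ i * (2 / \<delta>) < e" using \<open>0 < \<delta>\<close> by (simp add: field_simps)
  show "\<exists>M. \<forall>\<mu>\<in>{\<delta>..}. \<forall>N\<ge>M. \<forall>N'\<ge>M. dist (t \<mu> N j) (t \<mu> N' j) < e"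
    using order.strict_trans1[OF fin_cf_diff_le_geometric[OF J] i] assms
    by (intro exI[of _ "j + 2 * i"]) (auto simp: dist_real_def)
qed

text \<open>Contraction is available only beyond an index depending on \<delta>; one Lipschitz step
  at a time carries the Cauchy property down from there to index 2.\<close>

lemma uniformly_Cauchy_fin_cf_Suc:
  assumes "uniformly_Cauchy_on {\<delta>..} (\<lambda>N \<mu>. t \<mu> N (Suc j))" and "0 < \<delta>" "2 \<le> j"
  shows "uniformly_Cauchy_on {\<delta>..} (\<lambda>N \<mu>. t \<mu> N j)"
proof (rule uniformly_Cauchy_onI)
  fix e :: real
  assume "0 < e"
  define K where "K = c (j - 1) * c (Suc j) / \<delta>\<^sup>2"
  have K: "0 < K" using assms coef_pos by (simp add: K_def)
  obtain M where M: "\<And>\<mu> N N'. \<delta> \<le> \<mu> \<Longrightarrow> M \<le> N \<Longrightarrow> M \<le> N' \<Longrightarrow>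
      \<bar>t \<mu> N (Suc j) - t \<mu> N' (Suc j)\<bar> < e / K"
    using assms(1) \<open>0 < e\<close> K unfolding uniformly_Cauchy_on_def dist_real_def
    by (metis atLeast_iff divide_pos_pos)
  have "\<bar>t \<mu> N j - t \<mu> N' j\<bar> < e" if h: "\<delta> \<le> \<mu>" "max j M \<le> N" "max j M \<le> N'" for \<mu> N N'
  proof -
    have "c (j - 1) * c (Suc j) / \<mu>\<^sup>2 \<le> K"
      unfolding K_def using assms h coef_pred_pos[of j] coef_pos[of "Suc j"]
      by (intro divide_left_mono power_mono) auto
    then have "\<bar>t \<mu> N j - t \<mu> N' j\<bar> \<le> K * \<bar>t \<mu> N (Suc j) - t \<mu> N' (Suc j)\<bar>"
      using fin_cf_diff_le[of \<mu> j N N'] h assms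
      by (intro order.trans[OF fin_cf_diff_le mult_right_mono]) auto
    also have "\<dots> < K * (e / K)" using M[of \<mu> N N'] h K by (intro mult_strict_left_mono) auto
    finally show ?thesis using K by simp
  qed
  then show "\<exists>M. \<forall>\<mu>\<in>{\<delta>..}. \<forall>N\<ge>M. \<forall>N'\<ge>M. dist (t \<mu> N j) (t \<mu> N' j) < e"
    by (intro exI[of _ "max j M"]) (auto simp: dist_real_def)
qed

lemma uniform_limit_cf:
  assumes "0 < \<delta>" "2 \<le> j"
  shows "uniform_limit {\<delta>..} (\<lambda>N \<mu>. t \<mu> N j) (r j) sequentially"
proof -
  obtain J where J: "1 \<le> J" "\<And>j. J \<le> j \<Longrightarrow> c j * c (Suc j) \<le> \<delta>\<^sup>2 / 2"
    using ex_coef_mult_Suc_small[of "\<delta>\<^sup>2 / 2"] assms by auto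
  have "uniformly_Cauchy_on {\<delta>..} (\<lambda>N \<mu>. t \<mu> N j)"
  proof (cases "J < j")
    case True
    then show ?thesis using uniformly_Cauchy_fin_cf_large J assms by blast
  next
    case False
    then have "j \<le> Suc J" by simp
    then show ?thesis using assms(2)
    proof (induction j rule: inc_induct)
      case base
      then show ?case using uniformly_Cauchy_fin_cf_large[OF J(2)] assms by simp
    next
      case (step j)
      then show ?case using uniformly_Cauchy_fin_cf_Suc assms by simp
    qed
  qed
  then have "uniformly_convergent_on {\<delta>..} (\<lambda>N \<mu>. t \<mu> N j)"
    by (rule Cauchy_uniformly_convergent)
  then show ?thesis unfolding uniformly_convergent_uniform_limit_iff cf_def .
qed

lemma fin_cf_tendsto:
  assumes "0 < \<mu>" "2 \<le> j"
  shows "(\<lambda>N. t \<mu> N j) \<longlonglongrightarrow> r j \<mu>"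
  using tendsto_uniform_limitI[OF uniform_limit_cf] assms by auto

lemma cf_nonneg:
  assumes "0 < \<mu>" "2 \<le> j"
  shows "0 \<le> r j \<mu>"
  using fin_cf_tendsto[OF assms] fin_cf_nonneg[OF assms] by (intro LIMSEQ_le_const) auto

lemma cf_rec:
  assumes "0 < \<mu>" "2 \<le> j"
  shows "r j \<mu> = c (j - 1) / (\<mu> + c (Suc j) * r (Suc j) \<mu>)"
proof (rule LIMSEQ_unique[OF fin_cf_tendsto[OF assms]])
  have "0 < \<mu> + c (Suc j) * r (Suc j) \<mu>"
    using assms coef_pos[of "Suc j"] cf_nonneg[of \<mu> "Suc j"] by (intro add_pos_nonneg) auto
  then have "(\<lambda>N. c (j - 1) / (\<mu> + c (Suc j) * t \<mu> N (Suc j)))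
      \<longlonglongrightarrow> c (j - 1) / (\<mu> + c (Suc j) * r (Suc j) \<mu>)"
    using assms by (intro tendsto_intros fin_cf_tendsto) auto
  then show "(\<lambda>N. t \<mu> N j) \<longlonglongrightarrow> c (j - 1) / (\<mu> + c (Suc j) * r (Suc j) \<mu>)"
    by (rule Lim_transform_eventually)
      (use eventually_ge_at_top[of j] in eventually_elim, simp add: fin_cf_rec)
qed

lemma cf_denom_pos:
  assumes "0 < \<mu>" "2 \<le> j"
  shows "0 < \<mu> + c j * r j \<mu>"
  using assms coef_pos[of j] cf_nonneg[of \<mu> j] by (intro add_pos_nonneg) auto

text \<open>Passing to the limit preserves only weak inequalities; strictness is recovered from the
  recursion, whose numerator is positive.\<close>

lemma cf_pos:
  assumes "0 < \<mu>" "2 \<le> j"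
  shows "0 < r j \<mu>"
  using cf_rec[OF assms] cf_denom_pos[of \<mu> "Suc j"] coef_pred_pos[of j] assms by simp

lemma cf_less:
  assumes "0 < \<mu>" "2 \<le> j"
  shows "r j \<mu> < c (j - 1) / \<mu>"
proof -
  have "0 < c (Suc j) * r (Suc j) \<mu>" using assms coef_pos[of "Suc j"] cf_pos[of \<mu> "Suc j"] by simp
  then show ?thesis using assms coef_pred_pos[of j]
    by (subst cf_rec) (auto intro!: divide_strict_left_mono mult_pos_pos)
qed

lemma continuous_on_fin_cf:
  assumes "2 \<le> j"
  shows "continuous_on {0<..} (\<lambda>\<mu>. t \<mu> N j)"
proof (cases "j \<le> N")
  case True
  then show ?thesis using assms
  proof (induction j rule: inc_induct)
    case base
    then show ?case by (auto simp: fin_cf_rec fin_cf_beyond intro!: continuous_intros)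
  next
    case (step j)
    have "\<mu> + c (Suc j) * t \<mu> N (Suc j) \<noteq> 0" if "0 < \<mu>" for \<mu>
      using cf_denom_ge[OF that, of j N] step.prems that by linarith
    moreover have "(\<lambda>\<mu>. t \<mu> N j) = (\<lambda>\<mu>. c (j - 1) / (\<mu> + c (Suc j) * t \<mu> N (Suc j)))"
      using step.hyps by (simp add: fin_cf_rec)
    ultimately show ?case using step.IH step.prems
      by (simp only:) (auto intro!: continuous_on_divide continuous_on_add continuous_on_mult)
  qed
qed (simp add: fin_cf_beyond)

lemma continuous_on_cf:
  assumes "2 \<le> j"
  shows "continuous_on {0<..} (r j)"
proof -
  have "isCont (r j) \<mu>" if "0 < \<mu>" for \<mu>
  proof -
    \<comment> \<open>Convergence is uniform only away from 0, so continuity is proved on a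
      half-line that has the given point in its interior.\<close>
    have "continuous_on {\<mu> / 2..} (r j)"
      using uniform_limit_cf[of "\<mu> / 2" j] assms that
      by (intro uniform_limit_theorem[OF _ uniform_limit_cf])
        (auto intro!: always_eventually continuous_on_subset[OF continuous_on_fin_cf])
    then have "continuous_on {\<mu> / 2<..} (r j)" by (rule continuous_on_subset) auto
    then show ?thesis using that by (simp add: continuous_on_eq_continuous_at)
  qed
  then show ?thesis by (simp add: continuous_on_eq_continuous_at)
qed

section \<open>Scaled monotonicity in \<mu>\<close>

lemma fin_cf_scaled_mono:
  assumes "0 < \<mu>" "\<mu> \<le> \<nu>"
  shows "2 \<le> j \<Longrightarrow> \<mu> * t \<mu> N j \<le> \<nu> * t \<nu> N j \<and> t \<nu> N j / \<nu> \<le> t \<mu> N j / \<mu>"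
proof (induction "Suc N - j" arbitrary: j)
  case 0
  then show ?case by (simp add: fin_cf_beyond)
next
  case (Suc d)
  have jN: "j \<le> N" and IH: "\<mu> * t \<mu> N (Suc j) \<le> \<nu> * t \<nu> N (Suc j)"
      "t \<nu> N (Suc j) / \<nu> \<le> t \<mu> N (Suc j) / \<mu>"
    using Suc by auto
  have pos: "0 < c (j - 1)" "0 < c (Suc j)" using Suc.prems coef_pos coef_pred_pos by auto
  have \<nu>: "0 < \<nu>" using assms by simp
  have nn: "0 \<le> t x N (Suc j)" if "0 < x" for x using fin_cf_nonneg that Suc.prems by simp
  \<comment> \<open>The two monotonicities must be proved together: the product at j depends on the
    quotient at \<open>Suc j\<close>, and the quotient at j on the product at
    \<open>Suc j\<close>.\<close>
  have scale: "x * t x N j = c (j - 1) / (1 + c (Suc j) * (t x N (Suc j) / x))"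
    "t x N j / x = c (j - 1) / (x\<^sup>2 + c (Suc j) * (x * t x N (Suc j)))" if "0 < x" for x
    using that nn[OF that] pos by (simp_all add: fin_cf_rec[OF jN] field_simps power2_eq_square)
  have "\<mu> * t \<mu> N j \<le> \<nu> * t \<nu> N j"
    unfolding scale[OF assms(1)] scale[OF \<nu>] using pos assms \<nu> nn IH
    by (intro divide_left_mono add_left_mono mult_left_mono mult_pos_pos add_pos_nonneg) auto
  moreover have "t \<nu> N j / \<nu> \<le> t \<mu> N j / \<mu>"
    unfolding scale[OF assms(1)] scale[OF \<nu>] using pos assms \<nu> nn IH
    by (intro divide_left_mono add_mono power_mono mult_left_mono mult_pos_pos add_pos_nonneg) auto
  ultimately show ?case by simp
qed

lemma cf_scaled_mono:
  assumes "0 < \<mu>" "\<mu> \<le> \<nu>" "2 \<le> j"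
  shows "\<mu> * r j \<mu> \<le> \<nu> * r j \<nu>"
  by (rule LIMSEQ_le[of "\<lambda>N. \<mu> * t \<mu> N j" _ "\<lambda>N. \<nu> * t \<nu> N j"])
    (use assms fin_cf_scaled_mono in \<open>auto intro!: tendsto_mult fin_cf_tendsto\<close>)

text \<open>This is \<mu> G(\<mu>). The positive function r_2 tends to 0 at infinity and so is not
  increasing; after multiplication by \<mu> every term is monotone in the right direction, and the
  pole at 0 is gone.\<close>

definition Lam :: "real \<Rightarrow> real" where
  "Lam \<mu> = \<mu>\<^sup>2 + c 2 * (\<mu> * r 2 \<mu>) + c 0 * c 1"

lemma G_eq_Lam: "0 < \<mu> \<Longrightarrow> G k n \<mu> = Lam \<mu> / \<mu>"
  by (simp add: G_def Lam_def field_simps power2_eq_square)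

lemma G_eq_0_iff: "0 < \<mu> \<Longrightarrow> G k n \<mu> = 0 \<longleftrightarrow> Lam \<mu> = 0"
  by (simp add: G_eq_Lam)

lemma Lam_strict_mono:
  assumes "0 < \<mu>" "\<mu> < \<nu>"
  shows "Lam \<mu> < Lam \<nu>"
proof -
  have "c 2 * (\<mu> * r 2 \<mu>) \<le> c 2 * (\<nu> * r 2 \<nu>)"
    using cf_scaled_mono[of \<mu> \<nu> 2] assms coef_pos[of 2] by (intro mult_left_mono) auto
  moreover have "\<mu>\<^sup>2 < \<nu>\<^sup>2" using assms by (intro power_strict_mono) auto
  ultimately show ?thesis by (simp add: Lam_def)
qed

section \<open>Behaviour near 0 and existence of the root\<close>

text \<open>
  With $v_j = c_j \mu r_j / c_{j-1}$ the recurrence at an even index becomes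
  $v_j \le y / (1 + y)$ for $y = \mu^2 / c_{j+1} + v_{j+2}$, because $c_j \le 1$. Iterating
  $y \mapsto y / (1 + y)$ from 1 gives $1, 1/2, 1/3, \ldots$, so $v_j \to 0$ as $\mu \to 0$.
\<close>

definition v :: "nat \<Rightarrow> real \<Rightarrow> real" where
  "v j \<mu> = c j * (\<mu> * r j \<mu>) / c (j - 1)"

lemma v_pos: "0 < \<mu> \<Longrightarrow> 2 \<le> j \<Longrightarrow> 0 < v j \<mu>"
  using coef_pos[of j] coef_pred_pos[of j] cf_pos[of \<mu> j] by (simp add: v_def)

lemma v_le_1:
  assumes "0 < \<mu>" "2 \<le> j" "even j"
  shows "v j \<mu> \<le> 1"
proof -
  have "\<mu> * r j \<mu> \<le> c (j - 1)"
    using cf_less[of \<mu> j] assms by (simp add: field_simps)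
  then have "c j * (\<mu> * r j \<mu>) \<le> 1 * c (j - 1)"
    using coef_even_le[of j] cf_pos[of \<mu> j] assms by (intro mult_mono) auto
  then show ?thesis using coef_pred_pos[of j] assms by (simp add: v_def divide_le_eq)
qed

lemma v_le_next:
  fixes \<mu> defines "y \<equiv> \<lambda>j. \<mu>\<^sup>2 / c (Suc j) + v (j + 2) \<mu>"
  assumes "0 < \<mu>" "2 \<le> j" "even j"
  shows "v j \<mu> \<le> y j / (1 + y j)"
proof -
  define R where "R = r (Suc (Suc j)) \<mu>"
  define D where "D = \<mu> + c (Suc (Suc j)) * R"
  have pos: "0 < c (j - 1)" "0 < c j" "0 < c (Suc j)" using assms coef_pos coef_pred_pos by auto
  have D: "0 < D" using cf_denom_pos[of \<mu> "Suc (Suc j)"] assms by (simp add: D_def R_def)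
  have yD: "y j = \<mu> * D / c (Suc j)"
    by (simp add: y_def v_def D_def R_def power2_eq_square distrib_left add_divide_distrib)
  have y: "0 < y j" using yD D pos assms by simp
  \<comment> \<open>Two steps of the recursion are unrolled, eliminating r at the odd index
    \<open>Suc j\<close>; this is why y refers to \<open>j + 2\<close>.\<close>
  have "r j \<mu> = c (j - 1) / (\<mu> + c (Suc j) * (c j / D))"
    using assms by (simp add: cf_rec[of \<mu> j] cf_rec[of \<mu> "Suc j"] D_def R_def)
  then have "v j \<mu> = c j * \<mu> / (\<mu> + c (Suc j) * (c j / D))"
    using pos by (simp add: v_def)
  also have "\<dots> = y j / (y j / c j + 1)"
    unfolding yD using pos D assms(2) by (simp add: divide_simps)
  also have "\<dots> \<le> y j / (1 + y j)"
  proof (rule divide_left_mono)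
    have "y j * c j \<le> y j * 1" using coef_even_le[of j] assms y by (intro mult_left_mono) auto
    then show "1 + y j \<le> y j / c j + 1" using pos by (simp add: le_divide_eq)
    show "0 < (y j / c j + 1) * (1 + y j)" using y pos by (intro mult_pos_pos add_pos_pos) auto
  qed (use y in simp)
  finally show ?thesis .
qed

text \<open>The error \<mu>^2 / c_{j+1} has an odd-indexed denominator tending to 0, so it is small
  only on neighbourhoods of 0 that shrink as j grows. Hence the number i of iterations is fixed
  first and \<mu> tends to 0 afterwards, with j and e free in the induction.\<close>

lemma v_eventually_less:
  "2 \<le> j \<Longrightarrow> even j \<Longrightarrow> 0 < e \<Longrightarrow> \<forall>\<^sub>F \<mu> in at_right 0. v j \<mu> < 1 / real (Suc i) + e"
proof (induction i arbitrary: j e)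
  case 0
  show ?case using eventually_at_right_less[of 0]
  proof eventually_elim
    case (elim \<mu>)
    then show ?case using v_le_1[of \<mu> j] 0 by simp
  qed
next
  case (Suc i)
  have "((\<lambda>\<mu>. \<mu>\<^sup>2 / c (Suc j)) \<longlongrightarrow> 0\<^sup>2 / c (Suc j)) (at_right 0)"
    using coef_pos[of "Suc j"] by (intro tendsto_intros) auto
  then have "\<forall>\<^sub>F \<mu> in at_right 0. \<mu>\<^sup>2 / c (Suc j) < e / 2"
    using Suc.prems by (intro order_tendstoD(2)) auto
  moreover have "\<forall>\<^sub>F \<mu> in at_right 0. v (j + 2) \<mu> < 1 / real (Suc i) + e / 2"
    using Suc.prems by (intro Suc.IH) auto
  ultimately show ?case using eventually_at_right_less[of 0]
  proof eventually_elim
    case (elim \<mu>)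
    define y where "y = \<mu>\<^sup>2 / c (Suc j) + v (j + 2) \<mu>"
    define a where "a = 1 / real (Suc i)"
    have y: "0 < y" "y < a + e" and a: "0 < a"
      using elim(1,2) v_pos[of \<mu> "j + 2"] coef_pos[of "Suc j"] elim(3) Suc.prems
      unfolding y_def a_def by (simp add: add_nonneg_pos, linarith, simp)
    have "v j \<mu> \<le> y / (1 + y)" using v_le_next[of \<mu> j] elim Suc.prems by (simp add: y_def)
    also have "\<dots> < a / (1 + a) + e"
    proof -
      \<comment> \<open>The map y / (1 + y) is increasing with slope at most 1 on the positive axis,
        so the excess e over a is not amplified.\<close>
      have "y / (1 + y) - a / (1 + a) = (y - a) / ((1 + y) * (1 + a))"
        using y a by (simp add: field_simps)
      also have "\<dots> < e"
      proof (cases "y \<le> a")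
        case True
        then have "(y - a) / ((1 + y) * (1 + a)) \<le> 0"
          using y a by (intro divide_nonpos_pos mult_pos_pos) auto
        then show ?thesis using Suc.prems by linarith
      next
        case False
        have "1 * 1 \<le> (1 + y) * (1 + a)" using y a by (intro mult_mono) auto
        then have "(y - a) / ((1 + y) * (1 + a)) \<le> (y - a) / 1"
          using False by (intro divide_left_mono) auto
        then show ?thesis using y by simp
      qed
      finally show ?thesis by simp
    qed
    also have "a / (1 + a) = 1 / real (Suc (Suc i))" by (simp add: a_def field_simps)
    finally show ?case .
  qed
qed

lemma ex_Lam_neg: "\<exists>\<mu>>0. Lam \<mu> < 0"
proof -
  \<comment> \<open>With 1 / (i + 1) < e the three terms of \<open>Lam\<close> add up to less than
    c_1 (e + 2 e - 4 e) = - c_1 e.\<close>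
  define e where "e = - c 0 / 4"
  have e: "0 < e" using coef_0_neg by (simp add: e_def)
  obtain i where i: "1 / real (Suc i) < e" using e nat_approx_posE by blast
  have "((\<lambda>\<mu>. \<mu>\<^sup>2) \<longlongrightarrow> (0::real)\<^sup>2) (at_right 0)" by (intro tendsto_intros)
  then have "\<forall>\<^sub>F \<mu> in at_right 0. \<mu>\<^sup>2 < c 1 * e"
    by (rule order_tendstoD(2)) (use e coef_pos[of 1] in auto)
  moreover have "\<forall>\<^sub>F \<mu> in at_right 0. v 2 \<mu> < 1 / real (Suc i) + e"
    using e by (intro v_eventually_less) auto
  ultimately have "\<forall>\<^sub>F \<mu> in at_right 0. 0 < \<mu> \<and> Lam \<mu> < 0"
    using eventually_at_right_less[of 0]
  proof eventually_elim
    case (elim \<mu>)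
    have "c 2 * (\<mu> * r 2 \<mu>) = c 1 * v 2 \<mu>" using coef_pos[of 1] by (simp add: v_def)
    also have "\<dots> < c 1 * (2 * e)" using elim i coef_pos[of 1] by (intro mult_strict_left_mono) auto
    finally have "Lam \<mu> < c 1 * e + c 1 * (2 * e) + c 0 * c 1"
      using elim(1) unfolding Lam_def by linarith
    also have "\<dots> = - c 1 * e" by (simp add: e_def field_simps)
    also have "\<dots> < 0" using e coef_pos[of 1] by simp
    finally show ?case using elim by simp
  qed
  then show ?thesis using eventually_happens trivial_limit_at_right_real by fast
qed

text \<open>Both bounds come from inserting 0 < \<mu> r_2(\<mu>) < c_1 into
  \<open>Lam \<mu> = 0\<close>.\<close>

lemma Lam_eq_0_bounds:
  assumes "0 < \<mu>" "Lam \<mu> = 0"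
  shows "- c 0 * c 1 - c 1 * c 2 \<le> \<mu>\<^sup>2" "\<mu>\<^sup>2 < - c 0 * c 1"
proof -
  have pos: "0 < c 1" "0 < c 2" "0 < r 2 \<mu>" using coef_pos cf_pos assms by auto
  have "\<mu> * r 2 \<mu> < c 1" using cf_less[of \<mu> 2] assms by (simp add: field_simps)
  then have "c 2 * (\<mu> * r 2 \<mu>) < c 2 * c 1" using pos by simp
  moreover have "0 < c 2 * (\<mu> * r 2 \<mu>)" using pos assms by simp
  ultimately show "- c 0 * c 1 - c 1 * c 2 \<le> \<mu>\<^sup>2" "\<mu>\<^sup>2 < - c 0 * c 1"
    using assms(2) by (simp_all add: Lam_def mult.commute)
qed

lemma ex_Lam_root: "\<exists>\<mu>>0. Lam \<mu> = 0"
proof -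
  obtain a where a: "0 < a" "Lam a < 0" using ex_Lam_neg by blast
  \<comment> \<open>At b the terms \<mu>^2 and c_0 c_1 cancel, leaving the positive term with
    r_2.\<close>
  define b where "b = sqrt (- c 0 * c 1)"
  have m: "0 < - c 0 * c 1" using coef_0_neg coef_pos[of 1] by (intro mult_pos_pos) auto
  then have b: "0 < b" "b\<^sup>2 = - c 0 * c 1" by (auto simp: b_def)
  have Lb: "0 < Lam b" using b coef_pos[of 2] cf_pos[of b 2] by (simp add: Lam_def)
  have ab: "a \<le> b" using Lam_strict_mono[of b a] a b Lb by (cases "a \<le> b") auto
  have "continuous_on {a..b} Lam" unfolding Lam_def
    using a by (intro continuous_intros continuous_on_subset[OF continuous_on_cf]) auto
  then obtain \<mu> where "a \<le> \<mu>" "Lam \<mu> = 0" using IVT'[of Lam a 0 b] a ab Lb by auto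
  then show ?thesis using a by (intro exI[of _ \<mu>]) auto
qed

lemma Lam_root_unique: "0 < \<mu> \<Longrightarrow> 0 < \<nu> \<Longrightarrow> Lam \<mu> = 0 \<Longrightarrow> Lam \<nu> = 0 \<Longrightarrow> \<mu> = \<nu>"
  using Lam_strict_mono[of \<mu> \<nu>] Lam_strict_mono[of \<nu> \<mu>] by (cases \<mu> \<nu> rule: linorder_cases) auto

section \<open>Growing and decaying solutions of the recurrence\<close>

text \<open>
  The defects $d_j = q_j - r_j q_{j-1}$ satisfy $c_{j+1} d_{j+1} = -(c_{j-1} / r_j) d_j$. Since
  $c_{j-1} / r_j > \mu$ and $c_{j+1} c_{j+2} \to 0$, they grow faster than every geometric
  sequence unless they vanish.
\<close>

lemma solves_recurrence_imp_ratio: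
  assumes sol: "solves_recurrence k n \<mu> q" and "0 < \<mu>"
    and bound: "\<And>j. cmod (q j) \<le> C * R ^ j" and "1 \<le> R" and "2 \<le> j"
  shows "q j = of_real (r j \<mu>) * q (j - 1)"
proof -
  define d where "d j = q j - of_real (r j \<mu>) * q (j - 1)" for j
  have d_Suc: "of_real (c (Suc j)) * d (Suc j) = - of_real (c (j - 1) / r j \<mu>) * d j" if "2 \<le> j" for j
  proof -
    have rj: "0 < r j \<mu>" using cf_pos assms that by simp
    have "c (j - 1) = r j \<mu> * (\<mu> + c (Suc j) * r (Suc j) \<mu>)"
      using cf_rec[of \<mu> j] cf_denom_pos[of \<mu> "Suc j"] assms that by (simp add: field_simps)
    then have "c (Suc j) * r (Suc j) \<mu> = c (j - 1) / r j \<mu> - \<mu>" using rj by simp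
    then have e: "of_real (c (Suc j)) * of_real (r (Suc j) \<mu>)
        = (of_real (c (j - 1) / r j \<mu>) - of_real \<mu> :: complex)"
      by (metis of_real_mult of_real_diff)
    have s: "of_real (c (Suc j)) * q (Suc j) = of_real (c (j - 1)) * q (j - 1) - of_real \<mu> * q j"
      using sol that unfolding solves_recurrence_def by simp
    have "of_real (c (Suc j)) * d (Suc j)
        = of_real (c (Suc j)) * q (Suc j) - (of_real (c (Suc j)) * of_real (r (Suc j) \<mu>)) * q j"
      by (simp add: d_def algebra_simps)
    also have "\<dots> = - of_real (c (j - 1) / r j \<mu>) * d j"
      unfolding e s using rj by (simp add: d_def field_simps)
    finally show ?thesis .
  qed
  have d_step: "\<mu> * cmod (d j) \<le> c (Suc j) * cmod (d (Suc j))" if "2 \<le> j" for j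
  proof -
    have rj: "0 < r j \<mu>" using cf_pos assms that by simp
    have "\<mu> \<le> c (j - 1) / r j \<mu>"
      using cf_less[of \<mu> j] rj assms that by (simp add: field_simps)
    then have "\<mu> * cmod (d j) \<le> c (j - 1) / r j \<mu> * cmod (d j)" by (intro mult_right_mono) auto
    also have "\<dots> = cmod (of_real (c (Suc j)) * d (Suc j))"
      unfolding d_Suc[OF that] norm_mult norm_minus_cancel norm_of_real
      using rj coef_pred_pos[of j] that by simp
    also have "\<dots> = c (Suc j) * cmod (d (Suc j))" using coef_pos[of "Suc j"] by (simp add: norm_mult)
    finally show ?thesis .
  qed
  \<comment> \<open>The threshold makes two steps multiply the defect by at least 4 R^2, whereas the
    assumed bound allows only R^2; the surplus 4 gives the contradiction.\<close>
  obtain J where J: "1 \<le> J" "\<And>j. J \<le> j \<Longrightarrow> c j * c (Suc j) \<le> \<mu>\<^sup>2 / (4 * R\<^sup>2)"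
    using ex_coef_mult_Suc_small[of "\<mu>\<^sup>2 / (4 * R\<^sup>2)"] assms by auto
  have two_step: "4 * R\<^sup>2 * cmod (d j) \<le> cmod (d (Suc (Suc j)))" if "2 \<le> j" "J \<le> j" for j
  proof -
    have "\<mu> * (\<mu> * cmod (d j)) \<le> \<mu> * (c (Suc j) * cmod (d (Suc j)))"
      using d_step[of j] that assms by (intro mult_left_mono) auto
    also have "\<dots> = c (Suc j) * (\<mu> * cmod (d (Suc j)))" by simp
    also have "\<dots> \<le> c (Suc j) * (c (Suc (Suc j)) * cmod (d (Suc (Suc j))))"
      using d_step[of "Suc j"] that coef_pos[of "Suc j"] by (intro mult_left_mono) auto
    also have "\<dots> \<le> \<mu>\<^sup>2 / (4 * R\<^sup>2) * cmod (d (Suc (Suc j)))"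
      using J(2)[of "Suc j"] that unfolding mult.assoc[symmetric] by (intro mult_right_mono) auto
    finally show ?thesis using assms by (simp add: field_simps power2_eq_square)
  qed
  \<comment> \<open>From |d_j| <= |q_j| + (2 / \<mu>) |q_{j-1}|, using R >= 1 to replace R^(j-1) by
    R^j.\<close>
  define K where "K = C * (1 + 2 / \<mu>)"
  have C: "0 \<le> C" using order.trans[OF norm_ge_zero bound[of 0]] by simp
  have d_le: "cmod (d j) \<le> K * R ^ j" if "2 \<le> j" for j
  proof -
    have rj: "0 \<le> r j \<mu>" "r j \<mu> \<le> 2 / \<mu>"
      using cf_nonneg[of \<mu> j] cf_less[of \<mu> j] coef_le_2[of "j - 1"] assms that
        divide_right_mono[of "c (j - 1)" 2 \<mu>] by auto
    have "cmod (d j) \<le> cmod (q j) + cmod (of_real (r j \<mu>) * q (j - 1))"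
      unfolding d_def by (rule norm_triangle_ineq4)
    also have "\<dots> = cmod (q j) + r j \<mu> * cmod (q (j - 1))"
      using rj by (simp add: norm_mult)
    also have "\<dots> \<le> C * R ^ j + 2 / \<mu> * (C * R ^ (j - 1))"
      using bound rj assms by (intro add_mono mult_mono) auto
    also have "\<dots> \<le> C * R ^ j + 2 / \<mu> * (C * R ^ j)"
      using assms C by (intro add_left_mono mult_left_mono power_increasing) auto
    also have "\<dots> = K * R ^ j" by (simp add: K_def algebra_simps)
    finally show ?thesis .
  qed
  have zero_large: "d j = 0" if "2 \<le> j" "J \<le> j" for j
  proof (rule ccontr)
    assume nz: "d j \<noteq> 0"
    have grow: "(4 * R\<^sup>2) ^ i * cmod (d j) \<le> cmod (d (j + 2 * i))" for i
    proof (induction i)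
      case (Suc i)
      have "(4 * R\<^sup>2) ^ Suc i * cmod (d j) \<le> 4 * R\<^sup>2 * cmod (d (j + 2 * i))"
        using mult_left_mono[OF Suc, of "4 * R\<^sup>2"] by (simp add: mult.assoc)
      also have "\<dots> \<le> cmod (d (Suc (Suc (j + 2 * i))))" using that by (intro two_step) auto
      finally show ?case by simp
    qed simp
    have le: "4 ^ i * cmod (d j) \<le> K * R ^ j" for i
    proof -
      have "R ^ (2 * i) * (4 ^ i * cmod (d j)) = (4 * R\<^sup>2) ^ i * cmod (d j)"
        by (simp add: power_mult_distrib power_mult)
      also have "\<dots> \<le> K * R ^ (j + 2 * i)" using grow[of i] d_le[of "j + 2 * i"] that by simp
      also have "\<dots> = R ^ (2 * i) * (K * R ^ j)" by (simp add: power_add)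
      finally show ?thesis using assms by (simp add: zero_less_power)
    qed
    obtain i where "K * R ^ j / cmod (d j) < 4 ^ i"
      using real_arch_pow[of 4] by auto
    then have "K * R ^ j < 4 ^ i * cmod (d j)" using nz by (simp add: divide_less_eq)
    then show False using le[of i] by simp
  qed
  \<comment> \<open>Below J there is no growth to exploit, but \<open>d_step\<close> bounds each
    defect by the next one, so vanishing propagates downwards.\<close>
  have "d j = 0"
  proof (cases "J \<le> j")
    case True
    then show ?thesis using zero_large assms by simp
  next
    case False
    then have "j \<le> J" by simp
    then show ?thesis using \<open>2 \<le> j\<close>
    proof (induction j rule: inc_induct)
      case base
      then show ?case using zero_large by simp
    next
      case (step i)
      then have "\<mu> * cmod (d i) \<le> 0" using d_step[of i] by simp
      then show ?case using assms by (simp add: mult_le_0_iff)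
    qed
  qed
  then show ?thesis by (simp add: d_def)
qed

text \<open>The candidate for the decaying solution, normalized to 1 at index 1. The first equation
  forces the value at 0, the continued fractions give the later ratios, and the second equation then
  becomes G = 0.\<close>

fun sol :: "real \<Rightarrow> nat \<Rightarrow> real" where
  "sol \<mu> 0 = - c 1 / \<mu>"
| "sol \<mu> (Suc 0) = 1"
| "sol \<mu> (Suc (Suc j)) = r (Suc (Suc j)) \<mu> * sol \<mu> (Suc j)"

lemma sol_rec: "2 \<le> j \<Longrightarrow> sol \<mu> j = r j \<mu> * sol \<mu> (j - 1)"
  by (cases "(\<mu>, j)" rule: sol.cases) auto

lemma sol_pos: "0 < \<mu> \<Longrightarrow> 0 < j \<Longrightarrow> 0 < sol \<mu> j"
  by (induction \<mu> j rule: sol.induct) (auto intro!: mult_pos_pos cf_pos)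

lemma solves_recurrence_sol:
  assumes "0 < \<mu>" "G k n \<mu> = 0"
  shows "solves_recurrence k n \<mu> (\<lambda>j. of_real (sol \<mu> j))"
proof -
  have "c 0 * sol \<mu> 0 = \<mu> * sol \<mu> 1 + c 2 * sol \<mu> 2"
    using assms by (simp add: G_def numeral_2_eq_2)
  moreover have "c (j - 1) * sol \<mu> (j - 1) = \<mu> * sol \<mu> j + c (j + 1) * sol \<mu> (j + 1)" if "2 \<le> j" for j
  proof -
    have "c (j - 1) = r j \<mu> * (\<mu> + c (Suc j) * r (Suc j) \<mu>)"
      using cf_rec[of \<mu> j] cf_denom_pos[of \<mu> "Suc j"] assms that by (simp add: field_simps)
    then show ?thesis
      using sol_rec[of j \<mu>] sol_rec[of "Suc j" \<mu>] that by (simp add: algebra_simps)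
  qed
  moreover have "\<mu> * sol \<mu> 0 = - c 1 * sol \<mu> 1" using assms by simp
  ultimately show ?thesis unfolding solves_recurrence_def
    by (simp flip: of_real_add of_real_minus of_real_mult)
qed

text \<open>Two consecutive ratios multiply to at most c_j c_{j+1} / \<mu>^2, which eventually is
  below 1 / R^2. Hence the values scaled by R^j are eventually nonincreasing along each parity
  class.\<close>

lemma sol_decay:
  assumes "0 < \<mu>" "1 \<le> R"
  obtains C where "0 < C" "\<And>j. \<bar>sol \<mu> j\<bar> * R ^ j \<le> C"
proof -
  obtain J where J: "1 \<le> J" "\<And>j. J \<le> j \<Longrightarrow> c j * c (Suc j) \<le> \<mu>\<^sup>2 / R\<^sup>2"
    using ex_coef_mult_Suc_small[of "\<mu>\<^sup>2 / R\<^sup>2"] assms by auto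
  define w where "w j = \<bar>sol \<mu> j\<bar> * R ^ j" for j
  have step: "w (Suc (Suc j)) \<le> w j" if "J \<le> j" for j
  proof -
    have "1 \<le> j" using that J by simp
    have "r (Suc (Suc j)) \<mu> * r (Suc j) \<mu> \<le> (c (Suc j) / \<mu>) * (c j / \<mu>)"
      using cf_less[of \<mu> "Suc (Suc j)"] cf_less[of \<mu> "Suc j"] cf_pos[of \<mu> "Suc (Suc j)"]
        cf_pos[of \<mu> "Suc j"] coef_pos[of "Suc j"] assms \<open>1 \<le> j\<close>
      by (intro mult_mono) auto
    also have "\<dots> = c j * c (Suc j) / \<mu>\<^sup>2" by (simp add: power2_eq_square)
    also have "\<dots> \<le> (\<mu>\<^sup>2 / R\<^sup>2) / \<mu>\<^sup>2" using J(2)[OF that] by (intro divide_right_mono) auto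
    also have "\<dots> = 1 / R\<^sup>2" using assms by simp
    finally have rr: "r (Suc (Suc j)) \<mu> * r (Suc j) \<mu> \<le> 1 / R\<^sup>2" .
    have "sol \<mu> (Suc (Suc j)) = (r (Suc (Suc j)) \<mu> * r (Suc j) \<mu>) * sol \<mu> j"
      using sol_rec[of "Suc j" \<mu>] \<open>1 \<le> j\<close> by simp
    then have "\<bar>sol \<mu> (Suc (Suc j))\<bar> = (r (Suc (Suc j)) \<mu> * r (Suc j) \<mu>) * \<bar>sol \<mu> j\<bar>"
      using cf_pos[of \<mu> "Suc (Suc j)"] cf_pos[of \<mu> "Suc j"] assms \<open>1 \<le> j\<close>
      by (simp add: abs_mult)
    also have "\<dots> \<le> 1 / R\<^sup>2 * \<bar>sol \<mu> j\<bar>" using rr by (intro mult_right_mono) auto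
    finally have "\<bar>sol \<mu> (Suc (Suc j))\<bar> \<le> 1 / R\<^sup>2 * \<bar>sol \<mu> j\<bar>" .
    then have "w (Suc (Suc j)) \<le> 1 / R\<^sup>2 * \<bar>sol \<mu> j\<bar> * R ^ Suc (Suc j)"
      unfolding w_def using assms by (intro mult_right_mono) auto
    also have "\<dots> = w j" using assms by (simp add: w_def power2_eq_square)
    finally show ?thesis .
  qed
  \<comment> \<open>The sum up to \<open>Suc J\<close> dominates the starting values of both parity
    classes; the summand 1 makes C positive.\<close>
  define C where "C = 1 + (\<Sum>i\<le>Suc J. w i)"
  have w0: "0 \<le> w j" for j using assms by (simp add: w_def)
  have "w j \<le> C" for j
  proof (induction j rule: less_induct)
    case (less j)
    show ?case
    proof (cases "j \<le> Suc J")
      case True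
      then have "w j \<le> (\<Sum>i\<le>Suc J. w i)" using w0 by (intro member_le_sum) auto
      then show ?thesis by (simp add: C_def)
    next
      case False
      define i where "i = j - 2"
      have "j = Suc (Suc i)" "J \<le> i" using False by (auto simp: i_def)
      then show ?thesis using step[of i] less[of i] by simp
    qed
  qed
  moreover have "0 < C" using w0 unfolding C_def by (intro add_pos_nonneg sum_nonneg) auto
  ultimately show ?thesis unfolding w_def by (intro that[of C])
qed

text \<open>The geometric bound lets one statement serve square-summable sequences (R = 1) and
  Sobolev coefficients of any order. The ratios and the first equation express all of q through
  \<open>q 1\<close>, which is therefore nonzero; the second equation then reads G times
  \<open>q 1\<close> equals 0.\<close>

lemma G_eq_0_if_bounded_solution:
  assumes sol: "solves_recurrence k n \<mu> q" and "0 < \<mu>"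
    and bound: "\<And>j. cmod (q j) \<le> C * R ^ j" and "1 \<le> R" and "q \<noteq> (\<lambda>_. 0)"
  shows "G k n \<mu> = 0"
proof -
  note ratio = solves_recurrence_imp_ratio[OF sol \<open>0 < \<mu>\<close> bound \<open>1 \<le> R\<close>]
  have q0: "of_real \<mu> * q 0 = - of_real (c 1) * q 1"
    and q1: "of_real (c 0) * q 0 = of_real \<mu> * q 1 + of_real (c 2) * q 2"
    using sol by (auto simp: solves_recurrence_def)
  have "q 1 \<noteq> 0"
  proof
    assume z: "q 1 = 0"
    have "q (Suc j) = 0" for j
    proof (induction j)
      case (Suc j)
      then show ?case using ratio[of "Suc (Suc j)"] by simp
    qed (use z in simp)
    moreover have "q 0 = 0" using q0 z assms by simp
    ultimately have "q j = 0" for j by (cases j) auto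
    with \<open>q \<noteq> (\<lambda>_. 0)\<close> show False by auto
  qed
  have q0': "q 0 = - of_real (c 1 / \<mu>) * q 1" using q0 assms by (simp add: field_simps)
  have "(of_real (G k n \<mu>) :: complex) * q 1 = 0"
  proof -
    have q2: "q 2 = of_real (r 2 \<mu>) * q 1" using ratio[of 2] by simp
    have "of_real (G k n \<mu>) * q 1
        = (of_real \<mu> * q 1 + of_real (c 2) * q 2) - of_real (c 0) * q 0"
      unfolding q2 q0' G_def by (simp add: algebra_simps)
    then show ?thesis using q1 by simp
  qed
  then show ?thesis using \<open>q 1 \<noteq> 0\<close> by simp
qed

lemma square_summable_solution_iff:
  assumes "0 < \<mu>"
  shows "(\<exists>q. q \<noteq> (\<lambda>_. 0) \<and> summable (\<lambda>j. (cmod (q j))\<^sup>2) \<and> solves_recurrence k n \<mu> q)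
    \<longleftrightarrow> G k n \<mu> = 0"
proof
  assume "\<exists>q. q \<noteq> (\<lambda>_. 0) \<and> summable (\<lambda>j. (cmod (q j))\<^sup>2) \<and> solves_recurrence k n \<mu> q"
  then obtain q where q: "q \<noteq> (\<lambda>_. 0)" "summable (\<lambda>j. (cmod (q j))\<^sup>2)" "solves_recurrence k n \<mu> q"
    by blast
  have "cmod (q j) \<le> sqrt (\<Sum>i. (cmod (q i))\<^sup>2) * 1 ^ j" for j
    using sum_le_suminf[OF q(2), of "{j}"] by (simp add: real_le_rsqrt)
  then show "G k n \<mu> = 0" by (rule G_eq_0_if_bounded_solution[OF q(3) assms _ _ q(1)]) simp
next
  assume G: "G k n \<mu> = 0"
  obtain C where C: "0 < C" "\<And>j. \<bar>sol \<mu> j\<bar> * 2 ^ j \<le> C" using sol_decay[of \<mu> 2] assms by auto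
  have "norm ((cmod (of_real (sol \<mu> j)))\<^sup>2) \<le> C\<^sup>2 * (1 / 4) ^ j" for j
  proof -
    have "\<bar>sol \<mu> j\<bar> \<le> C * (1 / 2) ^ j" using C(2)[of j] by (simp add: field_simps)
    then have "\<bar>sol \<mu> j\<bar>\<^sup>2 \<le> (C * (1 / 2) ^ j)\<^sup>2" by (intro power_mono) auto
    also have "\<dots> = C\<^sup>2 * ((1 / 2)\<^sup>2) ^ j"
      by (simp only: power_mult_distrib power_mult[symmetric] mult.commute[of j 2])
    also have "\<dots> = C\<^sup>2 * (1 / 4) ^ j" by (simp add: power2_eq_square)
    finally show ?thesis by simp
  qed
  moreover have "summable (\<lambda>j. C\<^sup>2 * (1 / 4) ^ j)"
    by (rule summable_mult) (simp add: summable_geometric)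
  ultimately have "summable (\<lambda>j. (cmod (of_real (sol \<mu> j)))\<^sup>2)"
    by (rule summable_comparison_test'[rotated])
  moreover have "(\<lambda>j. of_real (sol \<mu> j) :: complex) \<noteq> (\<lambda>_. 0)"
    by (auto simp: fun_eq_iff intro!: exI[of _ "Suc 0"])
  ultimately show "\<exists>q. q \<noteq> (\<lambda>_. 0) \<and> summable (\<lambda>j. (cmod (q j))\<^sup>2) \<and> solves_recurrence k n \<mu> q"
    using solves_recurrence_sol[OF assms G] by (intro exI[of _ "\<lambda>j. of_real (sol \<mu> j)"] conjI)
qed

section \<open>Eigenvalues of the cosine chain\<close>

definition sin_n :: dist1 where "sin_n = fourier (\<lambda>x. sin (of_int n * x))"
definition cos_n :: dist1 where "cos_n = fourier (\<lambda>x. cos (of_int n * x))"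

lemma sin_n_eq: "sin_n b = (of_bool (b = n) - of_bool (b = - n)) / (2 * \<i>)"
  and cos_n_eq: "cos_n b = (of_bool (b = n) + of_bool (b = - n)) / 2"
  by (simp_all add: sin_n_def cos_n_def fourier_sin fourier_cos)

lemma tensor_apply [simp]: "tensor f g (a, b) = f a * g b"
  by (simp add: tensor_def)

text \<open>The symbol of \<open>A_op k\<close> at the frequencies (a, n) and (a, - n), equal
  because only n^2 enters.\<close>

definition symb_A :: "int \<Rightarrow> real" where
  "symb_A a = 1 - (1 + (of_int k)\<^sup>2) / (1 + (of_int a)\<^sup>2 + (of_int n)\<^sup>2)"

definition symb_B :: "int \<Rightarrow> real" where
  "symb_B a = (1 + (of_int k)\<^sup>2) / ((of_int a)\<^sup>2 + (of_int n)\<^sup>2)"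

text \<open>The sign opposite to that of \<open>chain_B\<close> comes from differentiating cos
  rather than sin in x_2; the factor 1/2 is that of \<open>mult_cos\<close>.\<close>

definition chain_A :: "dist1 \<Rightarrow> dist1" where
  "chain_A f a = of_int (n * k) / 2 * (of_real (symb_A (a - k)) * f (a - k) + of_real (symb_A (a + k)) * f (a + k))"

definition chain_B :: "dist1 \<Rightarrow> dist1" where
  "chain_B h a = - of_int (n * k) / 2 * (of_real (symb_B (a - k)) * h (a - k) + of_real (symb_B (a + k)) * h (a + k))"

lemma d2_tensor_cos: "\<i> * of_int b * cos_n b = - of_int n * sin_n b"
  by (auto simp: sin_n_eq cos_n_eq mult_ac)

lemma d2_tensor_sin: "\<i> * of_int b * sin_n b = of_int n * cos_n b"
  by (auto simp: sin_n_eq cos_n_eq mult_ac)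

lemma d2_A_tensor:
  "d2 (A_op k (tensor f cos_n)) (a, b) = - of_int n * (of_real (symb_A a) * f a) * sin_n b"
proof -
  have "A_op k (tensor f cos_n) (a, b) = of_real (symb_A a) * f a * cos_n b"
  \<comment> \<open>At b = n and b = - n the multiplier depends on b only through n^2; at all other
    b the factor \<open>cos_n b\<close> vanishes.\<close>
  proof (cases "b\<^sup>2 = n\<^sup>2")
    case True
    then have "(of_int b :: complex)\<^sup>2 = (of_int n)\<^sup>2" by (metis of_int_power)
    then show ?thesis
      by (simp add: A_op_def inv_one_minus_laplace_def freq_sq_def symb_A_def left_diff_distrib add.assoc)
  next
    case False
    then have "cos_n b = 0" by (auto simp: cos_n_eq)
    then show ?thesis by (simp add: A_op_def inv_one_minus_laplace_def)
  qed
  then have "d2 (A_op k (tensor f cos_n)) (a, b) = of_real (symb_A a) * f a * (\<i> * of_int b * cos_n b)"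
    by (simp add: d2_def mult_ac)
  then show ?thesis unfolding d2_tensor_cos by (simp add: mult_ac)
qed

lemma B_op_eq: "B_op k u \<xi> = (1 + (of_int k)\<^sup>2) * u \<xi> / of_real (freq_sq \<xi>)"
  unfolding B_op_def inv_laplace_def
  by (simp only: mult_minus_left mult_minus_right minus_divide_left[symmetric] minus_minus times_divide_eq_right)

lemma d2_B_tensor:
  "d2 (B_op k (tensor h sin_n)) (a, b) = of_int n * (of_real (symb_B a) * h a) * cos_n b"
proof -
  have "B_op k (tensor h sin_n) (a, b) = of_real (symb_B a) * h a * sin_n b"
  proof (cases "b\<^sup>2 = n\<^sup>2")
    case True
    then have "(of_int b :: complex)\<^sup>2 = (of_int n)\<^sup>2" by (metis of_int_power)
    then show ?thesis
      by (simp add: B_op_eq freq_sq_def symb_B_def mult.assoc)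
  next
    case False
    then have "sin_n b = 0" by (auto simp: sin_n_eq)
    then show ?thesis by (simp add: B_op_eq)
  qed
  then have "d2 (B_op k (tensor h sin_n)) (a, b) = of_real (symb_B a) * h a * (\<i> * of_int b * sin_n b)"
    by (simp add: d2_def mult_ac)
  then show ?thesis unfolding d2_tensor_sin by (simp add: mult_ac)
qed

lemma L_op_tensor:
  "L_op k (tensor h sin_n, tensor f cos_n) = (tensor (chain_A f) sin_n, tensor (chain_B h) cos_n)"
proof -
  have "- of_int k * mult_cos k (d2 (A_op k (tensor f cos_n))) (a, b) = tensor (chain_A f) sin_n (a, b)" for a b
    unfolding mult_cos_def by (simp add: d2_A_tensor chain_A_def algebra_simps add_divide_distrib)
  moreover have "- of_int k * mult_cos k (d2 (B_op k (tensor h sin_n))) (a, b) = tensor (chain_B h) cos_n (a, b)" for a b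
    unfolding mult_cos_def by (simp add: d2_B_tensor chain_B_def algebra_simps add_divide_distrib)
  ultimately show ?thesis unfolding L_op_def by (auto simp: fun_eq_iff)
qed

lemma sin_n_n: "sin_n n \<noteq> 0" and cos_n_n: "cos_n n \<noteq> 0"
  using n_pos by (auto simp: sin_n_eq cos_n_eq)

lemma tensor_eq_scaled_iff:
  assumes "g n \<noteq> 0"
  shows "tensor u g = (\<lambda>\<xi>. l * tensor w g \<xi>) \<longleftrightarrow> u = (\<lambda>a. l * w a)"
proof
  assume *: "tensor u g = (\<lambda>\<xi>. l * tensor w g \<xi>)"
  show "u = (\<lambda>a. l * w a)"
  proof
    fix a
    have "u a * g n = l * (w a * g n)" using fun_cong[OF *, of "(a, n)"] by simp
    then show "u a = l * w a" using assms by simp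
  qed
qed (auto simp: tensor_def)

lemma eigen_tensor_iff:
  "L_op k (tensor h sin_n, tensor f cos_n) = ((\<lambda>\<xi>. l * tensor h sin_n \<xi>), (\<lambda>\<xi>. l * tensor f cos_n \<xi>))
    \<longleftrightarrow> chain_A f = (\<lambda>a. l * h a) \<and> chain_B h = (\<lambda>a. l * f a)"
  unfolding L_op_tensor
  using tensor_eq_scaled_iff[where g = sin_n, OF sin_n_n] tensor_eq_scaled_iff[where g = cos_n, OF cos_n_n]
  by simp

text \<open>
  A sequence \<open>y\<close> on the integers holds both components of a chain element: the
  coefficient at frequency \<open>i * k\<close> belongs to \<open>F\<close> for even \<open>i\<close>
  and to \<open>\<omega>\<close> for odd \<open>i\<close>.
\<close>

definition even_part :: "(int \<Rightarrow> complex) \<Rightarrow> dist1" where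
  "even_part y a = (if k dvd a \<and> even (a div k) then y (a div k) else 0)"

definition odd_part :: "(int \<Rightarrow> complex) \<Rightarrow> dist1" where
  "odd_part y a = (if k dvd a \<and> odd (a div k) then y (a div k) else 0)"

definition symb :: "int \<Rightarrow> real" where
  "symb i = (if even i then symb_A (i * k) else symb_B (i * k))"

text \<open>The eigenvalue equation at frequency \<open>i * k\<close> with the factor n k / 2
  cancelled: the \<omega> component for odd i, the F component for even i, where the minus sign is
  that of \<open>chain_B\<close>.\<close>

definition chain_eq :: "real \<Rightarrow> (int \<Rightarrow> complex) \<Rightarrow> int \<Rightarrow> bool" where
  "chain_eq \<mu> y i \<longleftrightarrow> of_real (symb (i - 1)) * y (i - 1) + of_real (symb (i + 1)) * y (i + 1)
     = of_real (if odd i then \<mu> else - \<mu>) * y i"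

lemma k_pos: "0 < k"
  using n_pos n_less_k by simp

lemma even_part_mult [simp]: "even_part y (i * k) = (if even i then y i else 0)"
  and odd_part_mult [simp]: "odd_part y (i * k) = (if odd i then y i else 0)"
  using k_pos by (auto simp: even_part_def odd_part_def)

lemma even_part_not_dvd: "\<not> k dvd a \<Longrightarrow> even_part y a = 0"
  and odd_part_not_dvd: "\<not> k dvd a \<Longrightarrow> odd_part y a = 0"
  by (auto simp: even_part_def odd_part_def)

lemma chain_A_mult:
  "chain_A f (i * k) = of_int (n * k) / 2 *
    (of_real (symb_A ((i - 1) * k)) * f ((i - 1) * k) + of_real (symb_A ((i + 1) * k)) * f ((i + 1) * k))"
  by (simp add: chain_A_def left_diff_distrib distrib_right)

lemma chain_B_mult:
  "chain_B h (i * k) = - of_int (n * k) / 2 *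
    (of_real (symb_B ((i - 1) * k)) * h ((i - 1) * k) + of_real (symb_B ((i + 1) * k)) * h ((i + 1) * k))"
  by (simp add: chain_B_def left_diff_distrib distrib_right)

text \<open>Each component of the system is nontrivial only at multiples of k of one parity; at the
  other parity and off the multiples of k both sides vanish. Together the two components give
  exactly one equation for each i.\<close>

lemma chain_system_iff:
  defines "\<Lambda> \<equiv> \<lambda>\<mu>. of_int n * of_int k * \<mu> / 2 :: real"
  shows "chain_A (even_part y) = (\<lambda>a. of_real (\<Lambda> \<mu>) * odd_part y a) \<and>
    chain_B (odd_part y) = (\<lambda>a. of_real (\<Lambda> \<mu>) * even_part y a) \<longleftrightarrow> (\<forall>i. chain_eq \<mu> y i)"
    (is "?A \<and> ?B \<longleftrightarrow> _")
proof -
  have nk: "(of_int n * of_int k :: complex) \<noteq> 0" using n_pos k_pos by simp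
  have A: "chain_A (even_part y) (i * k) = of_real (\<Lambda> \<mu>) * odd_part y (i * k) \<longleftrightarrow> even i \<or> chain_eq \<mu> y i" for i
  proof (cases "even i")
    case False
    define S where "S = of_real (symb (i - 1)) * y (i - 1) + of_real (symb (i + 1)) * y (i + 1)"
    have l: "chain_A (even_part y) (i * k) = (of_int n * of_int k) * (S / 2)"
      unfolding chain_A_mult using False by (simp add: symb_def S_def)
    have r: "of_real (\<Lambda> \<mu>) * odd_part y (i * k) = (of_int n * of_int k) * (of_real \<mu> * y i / 2)"
      using False by (simp add: \<Lambda>_def)
    have "chain_eq \<mu> y i \<longleftrightarrow> S = of_real \<mu> * y i" using False by (simp add: chain_eq_def S_def)
    then show ?thesis unfolding l r mult_cancel_left using nk False by simp
  qed (simp add: chain_A_mult)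
  have B: "chain_B (odd_part y) (i * k) = of_real (\<Lambda> \<mu>) * even_part y (i * k) \<longleftrightarrow> odd i \<or> chain_eq \<mu> y i" for i
  proof (cases "odd i")
    case False
    define S where "S = of_real (symb (i - 1)) * y (i - 1) + of_real (symb (i + 1)) * y (i + 1)"
    have l: "chain_B (odd_part y) (i * k) = (of_int n * of_int k) * (- (S / 2))"
      unfolding chain_B_mult using False by (simp add: symb_def S_def)
    have r: "of_real (\<Lambda> \<mu>) * even_part y (i * k) = (of_int n * of_int k) * (of_real \<mu> * y i / 2)"
      using False by (simp add: \<Lambda>_def)
    have "chain_B (odd_part y) (i * k) = of_real (\<Lambda> \<mu>) * even_part y (i * k)
        \<longleftrightarrow> - (S / 2) = of_real \<mu> * y i / 2"
      unfolding l r mult_cancel_left using nk by simp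
    also have "\<dots> \<longleftrightarrow> S = - (of_real \<mu> * y i)" by (simp add: minus_equation_iff[of S]) auto
    finally show ?thesis using False by (simp add: chain_eq_def S_def)
  qed (simp add: chain_B_mult)
  have off: "chain_A (even_part y) a = of_real (\<Lambda> \<mu>) * odd_part y a"
    "chain_B (odd_part y) a = of_real (\<Lambda> \<mu>) * even_part y a" if "\<not> k dvd a" for a
  proof -
    have "\<not> k dvd a - k" "\<not> k dvd a + k" using that by (auto simp: dvd_diff_left_iff)
    then show "chain_A (even_part y) a = of_real (\<Lambda> \<mu>) * odd_part y a"
      "chain_B (odd_part y) a = of_real (\<Lambda> \<mu>) * even_part y a"
      using that by (simp_all add: chain_A_def chain_B_def even_part_not_dvd odd_part_not_dvd)
  qed
  have "?A \<longleftrightarrow> (\<forall>i. even i \<or> chain_eq \<mu> y i)"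
  proof
    assume ?A then show "\<forall>i. even i \<or> chain_eq \<mu> y i" using A by (auto dest: fun_cong)
  next
    assume *: "\<forall>i. even i \<or> chain_eq \<mu> y i"
    show ?A
    proof
      fix a show "chain_A (even_part y) a = of_real (\<Lambda> \<mu>) * odd_part y a"
      proof (cases "k dvd a")
        case True
        then obtain i where "a = i * k" by (metis dvdE mult.commute)
        then show ?thesis using A[of i] * by blast
      qed (rule off)
    qed
  qed
  moreover have "?B \<longleftrightarrow> (\<forall>i. odd i \<or> chain_eq \<mu> y i)"
  proof
    assume ?B then show "\<forall>i. odd i \<or> chain_eq \<mu> y i" using B by (auto dest: fun_cong)
  next
    assume *: "\<forall>i. odd i \<or> chain_eq \<mu> y i"
    show ?B
    proof
      fix a show "chain_B (odd_part y) a = of_real (\<Lambda> \<mu>) * even_part y a"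
      proof (cases "k dvd a")
        case True
        then obtain i where "a = i * k" by (metis dvdE mult.commute)
        then show ?thesis using B[of i] * by blast
      qed (rule off)
    qed
  qed
  ultimately show ?thesis by blast
qed

section \<open>From the chain equations to the three-term recurrence\<close>

lemma symb_minus: "symb (- i) = symb i"
  by (simp add: symb_def symb_A_def symb_B_def)

lemma symb_eq_coef: "symb (int j) = (if j = 0 then c 0 / 2 else c j)"
proof -
  have "0 < 1 + (of_int n :: real)\<^sup>2" "0 < 1 + (of_int j * of_int k)\<^sup>2 + (of_int n :: real)\<^sup>2"
    by (intro add_pos_nonneg; simp)+
  then show ?thesis
    by (auto simp: symb_def symb_A_def symb_B_def coef_def divide_simps power_mult_distrib; simp add: algebra_simps)
qed

text \<open>Raising j by 2 flips this sign, which turns the sum of neighbours in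
  \<open>chain_eq\<close> into the difference in the recurrence. Its constancy on the pairs 2m, 2m+1
  absorbs the parity-dependent sign of \<mu>.\<close>

definition qsign :: "nat \<Rightarrow> complex" where
  "qsign j = (-1) ^ (j div 2)"

lemma qsign_square [simp]: "qsign j * qsign j = 1"
  by (simp add: qsign_def flip: power_add)

lemma qsign_ne_0 [simp]: "qsign j \<noteq> 0"
  by (simp add: qsign_def)

lemma qsign_Suc: "qsign (Suc j) = (if even j then qsign j else - qsign j)"
  by (auto simp: qsign_def elim!: evenE oddE)

lemma chain_eq_minus:
  assumes "\<And>i. y (- i) = y i"
  shows "chain_eq \<mu> y (- i) \<longleftrightarrow> chain_eq \<mu> y i"
proof -
  have neg: "- i - 1 = - (i + 1)" "- i + 1 = - (i - 1)" by simp_all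
  show ?thesis unfolding chain_eq_def neg symb_minus assms by (simp add: add.commute)
qed

text \<open>
  The factor 2 appears because $\cos(j k x)$ with $j > 0$ has Fourier coefficients $1/2$, but
  for $j = 0$ the coefficient 1; this is also why $c_0$ is twice the symbol at 0.
\<close>
lemma solves_recurrence_iff_chain_eq:
  assumes sym: "\<And>i. y (- i) = y i"
  defines "q \<equiv> \<lambda>j. qsign j * (if j = 0 then y 0 else 2 * y (int j))"
  shows "solves_recurrence k n \<mu> q \<longleftrightarrow> (\<forall>i. chain_eq \<mu> y i)"
proof -
  have 0: "of_real \<mu> * q 0 = - of_real (c 1) * q 1 \<longleftrightarrow> chain_eq \<mu> y 0"
  proof -
    \<comment> \<open>The neighbours 1 and -1 of frequency 0 contribute equally, which produces the
      factor 2 contained in \<open>q 1\<close>.\<close>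
    have "symb (-1) = c 1" "symb 1 = c 1" "y (-1) = y 1"
      using symb_minus[of 1] symb_eq_coef[of 1] sym[of 1] by simp_all
    then show ?thesis by (simp add: chain_eq_def q_def qsign_def) (auto simp: algebra_simps)
  qed
  have 1: "of_real (c 0) * q 0 = of_real \<mu> * q 1 + of_real (c 2) * q 2 \<longleftrightarrow> chain_eq \<mu> y 1"
  proof -
    have s: "symb 0 = c 0 / 2" "symb 2 = c 2"
      using symb_eq_coef[of 0] symb_eq_coef[of 2] by simp_all
    show ?thesis by (simp add: chain_eq_def q_def qsign_def s) (auto simp: field_simps)
  qed
  have ge_2: "of_real (c (j - 1)) * q (j - 1) = of_real \<mu> * q j + of_real (c (j + 1)) * q (j + 1)
      \<longleftrightarrow> chain_eq \<mu> y (int j)" if "2 \<le> j" for j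
  proof -
    define i where "i = j - 1"
    have i: "j = Suc i" "0 < i" using that by (auto simp: i_def)
    have s: "symb (int j - 1) = c i" "symb (int j + 1) = c (Suc j)"
      using symb_eq_coef[of i] symb_eq_coef[of "Suc j"] i by (auto simp: algebra_simps)
    have q: "q i = (if odd j then qsign j else - qsign j) * (2 * y (int j - 1))" "q j = qsign j * (2 * y (int j))"
      "q (Suc j) = (if even j then qsign j else - qsign j) * (2 * y (int j + 1))"
      using i qsign_Suc[of i] qsign_Suc[of j] by (auto simp: q_def algebra_simps)
    have "of_real (c (j - 1)) * q (j - 1) = of_real \<mu> * q j + of_real (c (j + 1)) * q (j + 1)
        \<longleftrightarrow> of_real (c i) * q i = of_real \<mu> * q j + of_real (c (Suc j)) * q (Suc j)" using i by simp
    also have "\<dots> \<longleftrightarrow> (2 * qsign j) * (of_real (c i) * (if odd j then 1 else -1) * y (int j - 1))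
        = (2 * qsign j) * (of_real \<mu> * y (int j) + of_real (c (Suc j)) * (if even j then 1 else -1) * y (int j + 1))"
      unfolding q by (simp add: algebra_simps)
    also have "\<dots> \<longleftrightarrow> of_real (c i) * (if odd j then 1 else -1) * y (int j - 1)
        = of_real \<mu> * y (int j) + of_real (c (Suc j)) * (if even j then 1 else -1) * y (int j + 1)"
      by (subst mult_cancel_left) simp
    also have "\<dots> \<longleftrightarrow> chain_eq \<mu> y (int j)"
      unfolding chain_eq_def s by (auto simp: algebra_simps eq_neg_iff_add_eq_0 neg_eq_iff_add_eq_0)
    finally show ?thesis .
  qed
  have "(\<forall>i. chain_eq \<mu> y i) \<longleftrightarrow> (\<forall>j. chain_eq \<mu> y (int j))"
    using chain_eq_minus[of y \<mu>, OF sym] by (metis int_cases2)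
  also have "\<dots> \<longleftrightarrow> chain_eq \<mu> y 0 \<and> chain_eq \<mu> y 1 \<and> (\<forall>j\<ge>2. chain_eq \<mu> y (int j))"
  proof -
    have "j = 0 \<or> j = 1 \<or> 2 \<le> j" for j :: nat by auto
    then show ?thesis by (metis of_nat_0 of_nat_1)
  qed
  finally show ?thesis unfolding solves_recurrence_def using 0 1 ge_2 by simp
qed

section \<open>Membership in the cosine chain and its eigenvalues\<close>

lemma even_span_iff:
  "f \<in> closed_span s (\<lambda>j. fourier (\<lambda>x. cos (2 * of_nat j * of_int k * x)))
    \<longleftrightarrow> f \<in> sobolev1 s \<and> (\<forall>a. f (- a) = f a) \<and> (\<forall>a. f a \<noteq> 0 \<longrightarrow> k dvd a \<and> even (a div k))"
proof -
  have "(\<exists>j. \<bar>a\<bar> = 2 * int j * k) \<longleftrightarrow> k dvd a \<and> even (a div k)" for a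
  proof
    assume "\<exists>j. \<bar>a\<bar> = 2 * int j * k"
    then obtain j where "\<bar>a\<bar> = 2 * int j * k" by blast
    then have "a = (2 * int j) * k \<or> a = (2 * (- int j)) * k" by (auto simp: abs_if split: if_splits)
    then obtain i where "a = (2 * i) * k" by blast
    then show "k dvd a \<and> even (a div k)" using k_pos by simp
  next
    assume "k dvd a \<and> even (a div k)"
    then obtain i where "a = 2 * i * k" by (metis dvd_def dvd_div_mult_self)
    then show "\<exists>j. \<bar>a\<bar> = 2 * int j * k" using k_pos by (intro exI[of _ "nat \<bar>i\<bar>"]) (auto simp: abs_mult)
  qed
  moreover have "inj (\<lambda>j. 2 * int j * k)" using k_pos by (auto simp: inj_on_def)
  ultimately show ?thesis
    using closed_span_cos_iff[of "\<lambda>j. 2 * int j * k" f s] k_pos by simp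
qed

lemma odd_span_iff:
  "h \<in> closed_span s (\<lambda>j. fourier (\<lambda>x. cos ((2 * of_nat j + 1) * of_int k * x)))
    \<longleftrightarrow> h \<in> sobolev1 s \<and> (\<forall>a. h (- a) = h a) \<and> (\<forall>a. h a \<noteq> 0 \<longrightarrow> k dvd a \<and> odd (a div k))"
proof -
  have "(\<exists>j. \<bar>a\<bar> = (2 * int j + 1) * k) \<longleftrightarrow> k dvd a \<and> odd (a div k)" for a
  proof
    assume "\<exists>j. \<bar>a\<bar> = (2 * int j + 1) * k"
    then obtain j where "\<bar>a\<bar> = (2 * int j + 1) * k" by blast
    then have "a = (2 * int j + 1) * k \<or> a = (2 * (- int j - 1) + 1) * k"
      by (auto simp: abs_if algebra_simps split: if_splits)
    then obtain i where "a = (2 * i + 1) * k" by blast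
    then show "k dvd a \<and> odd (a div k)" using k_pos by simp
  next
    assume "k dvd a \<and> odd (a div k)"
    then obtain i where a: "a = (2 * i + 1) * k" by (metis oddE dvd_div_mult_self)
    show "\<exists>j. \<bar>a\<bar> = (2 * int j + 1) * k"
    proof (cases "0 \<le> i")
      case True
      then show ?thesis using a k_pos by (intro exI[of _ "nat i"]) (simp add: abs_mult)
    next
      case False
      then show ?thesis using a k_pos by (intro exI[of _ "nat (- i - 1)"]) (simp add: abs_mult)
    qed
  qed
  moreover have "inj (\<lambda>j. (2 * int j + 1) * k)" using k_pos by (auto simp: inj_on_def)
  ultimately show ?thesis
    using closed_span_cos_iff[of "\<lambda>j. (2 * int j + 1) * k" h s] k_pos by simp
qed

text \<open>The profiles f and h occupy disjoint sets of frequencies, so one sequence y records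
  both, and its evenness says that only cosines occur. Nonvanishing transfers because
  \<open>sin_n\<close> and \<open>cos_n\<close> are nonzero at n.\<close>

lemma chain_eigenvalue_iff_chain_eq:
  fixes \<mu> s :: real
  shows "chain_eigenvalue s k n (of_real (of_int n * of_int k * \<mu> / 2)) \<longleftrightarrow>
    (\<exists>y. y \<noteq> (\<lambda>_. 0) \<and> (\<forall>i. y (- i) = y i) \<and> even_part y \<in> sobolev1 s \<and>
      odd_part y \<in> sobolev1 (s - 1) \<and> (\<forall>i. chain_eq \<mu> y i))"
    (is "chain_eigenvalue s k n ?l \<longleftrightarrow> _")
proof
  assume "chain_eigenvalue s k n ?l"
  then obtain \<omega> F h f where
    h: "h \<in> closed_span (s - 1) (\<lambda>j. fourier (\<lambda>x. cos ((2 * of_nat j + 1) * of_int k * x)))" and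
    f: "f \<in> closed_span s (\<lambda>j. fourier (\<lambda>x. cos (2 * of_nat j * of_int k * x)))" and
    \<omega>F: "\<omega> = tensor h sin_n" "F = tensor f cos_n" and
    nz: "(\<omega>, F) \<noteq> ((\<lambda>_. 0), (\<lambda>_. 0))" and
    L: "L_op k (\<omega>, F) = ((\<lambda>\<xi>. ?l * \<omega> \<xi>), (\<lambda>\<xi>. ?l * F \<xi>))"
    unfolding chain_eigenvalue_def cosine_chain_def sin_n_def cos_n_def by auto
  note h = h[unfolded odd_span_iff] and f = f[unfolded even_span_iff]
  define y where "y i = (if even i then f (i * k) else h (i * k))" for i
  have fy: "f = even_part y"
  proof
    fix a show "f a = even_part y a"
    proof (cases "k dvd a")
      case True
      then show ?thesis using f by (auto simp: even_part_def y_def)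
    qed (use f in \<open>auto simp: even_part_def\<close>)
  qed
  have hy: "h = odd_part y"
  proof
    fix a show "h a = odd_part y a"
    proof (cases "k dvd a")
      case True
      then show ?thesis using h by (auto simp: odd_part_def y_def)
    qed (use h in \<open>auto simp: odd_part_def\<close>)
  qed
  have "y \<noteq> (\<lambda>_. 0)"
  proof
    assume "y = (\<lambda>_. 0)"
    then have "f = (\<lambda>_. 0)" "h = (\<lambda>_. 0)" unfolding fy hy by (auto simp: even_part_def odd_part_def)
    then show False using nz by (auto simp: \<omega>F tensor_def)
  qed
  moreover have "y (- i) = y i" for i using f h by (simp add: y_def)
  moreover have "even_part y \<in> sobolev1 s" "odd_part y \<in> sobolev1 (s - 1)"
    using f h by (simp_all only: fy hy)
  moreover have "chain_A (even_part y) = (\<lambda>a. ?l * odd_part y a) \<and> chain_B (odd_part y) = (\<lambda>a. ?l * even_part y a)"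
    using L unfolding \<omega>F eigen_tensor_iff unfolding fy[symmetric] hy[symmetric] .
  then have "\<forall>i. chain_eq \<mu> y i" unfolding chain_system_iff .
  ultimately show "\<exists>y. y \<noteq> (\<lambda>_. 0) \<and> (\<forall>i. y (- i) = y i) \<and> even_part y \<in> sobolev1 s \<and>
      odd_part y \<in> sobolev1 (s - 1) \<and> (\<forall>i. chain_eq \<mu> y i)"
    by (intro exI[of _ y] conjI allI) auto
next
  assume "\<exists>y. y \<noteq> (\<lambda>_. 0) \<and> (\<forall>i. y (- i) = y i) \<and> even_part y \<in> sobolev1 s \<and>
      odd_part y \<in> sobolev1 (s - 1) \<and> (\<forall>i. chain_eq \<mu> y i)"
  then obtain y where y: "y \<noteq> (\<lambda>_. 0)" "\<And>i. y (- i) = y i" "even_part y \<in> sobolev1 s"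
    "odd_part y \<in> sobolev1 (s - 1)" "\<forall>i. chain_eq \<mu> y i" by blast
  define f where "f = even_part y"
  define h where "h = odd_part y"
  \<comment> \<open>Integer division commutes with negation on multiples of k, which is what
    evenness of the two profiles requires.\<close>
  have div_minus: "- a div k = - (a div k)" if "k dvd a" for a using that by (rule dvd_neg_div)
  have f: "f \<in> closed_span s (\<lambda>j. fourier (\<lambda>x. cos (2 * of_nat j * of_int k * x)))"
    unfolding even_span_iff f_def using y by (auto simp: even_part_def div_minus)
  have h: "h \<in> closed_span (s - 1) (\<lambda>j. fourier (\<lambda>x. cos ((2 * of_nat j + 1) * of_int k * x)))"
    unfolding odd_span_iff h_def using y by (auto simp: odd_part_def div_minus)
  have fin: "finite {b. sin_n b \<noteq> 0}" "finite {b. cos_n b \<noteq> 0}"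
    by (rule finite_subset[of _ "{n, - n}"]; auto simp: sin_n_eq cos_n_eq split: if_splits)+
  have chain_mem: "(tensor h sin_n, tensor f cos_n) \<in> cosine_chain s k n"
  proof -
    have "tensor h sin_n (0, 0) = 0" using n_pos by (simp add: sin_n_eq)
    then have "(tensor h sin_n, tensor f cos_n) \<in> X_space s"
      using sobolev2_tensor[OF y(4) fin(1)] sobolev2_tensor[OF y(3) fin(2)]
      by (simp add: X_space_def f_def h_def)
    then show ?thesis unfolding cosine_chain_def using f h by (auto simp: sin_n_def cos_n_def)
  qed
  have "(tensor h sin_n, tensor f cos_n) \<noteq> ((\<lambda>_. 0), (\<lambda>_. 0))"
  proof
    assume z: "(tensor h sin_n, tensor f cos_n) = ((\<lambda>_. 0), (\<lambda>_. 0))"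
    have "y i = 0" for i
    proof (cases "even i")
      case True
      have "tensor f cos_n (i * k, n) = 0" using z by simp
      then show ?thesis using True cos_n_n by (simp add: f_def)
    next
      case False
      have "tensor h sin_n (i * k, n) = 0" using z by simp
      then show ?thesis using False sin_n_n by (simp add: h_def)
    qed
    with y(1) show False by auto
  qed
  moreover have "L_op k (tensor h sin_n, tensor f cos_n)
      = ((\<lambda>\<xi>. ?l * tensor h sin_n \<xi>), (\<lambda>\<xi>. ?l * tensor f cos_n \<xi>))"
    unfolding eigen_tensor_iff f_def h_def chain_system_iff by (rule y(5))
  ultimately show "chain_eigenvalue s k n ?l"
    unfolding chain_eigenvalue_def using chain_mem by (intro bexI[of _ "(tensor h sin_n, tensor f cos_n)"]) auto
qed

text \<open>Sobolev membership is used in one direction only through geometric growth bounds and is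
  obtained in the other from geometric decay, both valid for every order.\<close>

lemma chain_eigenvalue_iff_G:
  fixes \<mu> s :: real
  assumes "0 < \<mu>"
  shows "chain_eigenvalue s k n (of_real (of_int n * of_int k * \<mu> / 2)) \<longleftrightarrow> G k n \<mu> = 0"
  unfolding chain_eigenvalue_iff_chain_eq
proof
  assume "\<exists>y. y \<noteq> (\<lambda>_. 0) \<and> (\<forall>i. y (- i) = y i) \<and> even_part y \<in> sobolev1 s \<and>
      odd_part y \<in> sobolev1 (s - 1) \<and> (\<forall>i. chain_eq \<mu> y i)"
  then obtain y where y: "y \<noteq> (\<lambda>_. 0)" "\<And>i. y (- i) = y i" "even_part y \<in> sobolev1 s"
    "odd_part y \<in> sobolev1 (s - 1)" "\<forall>i. chain_eq \<mu> y i" by blast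
  define q where "q j = qsign j * (if j = 0 then y 0 else 2 * y (int j))" for j
  have sol: "solves_recurrence k n \<mu> q"
    using solves_recurrence_iff_chain_eq[of y \<mu>, OF y(2)] y(5) by (simp add: q_def[abs_def])
  obtain C where C: "\<And>a. cmod (even_part y a) \<le> C * 2 ^ nat \<bar>a\<bar>" 
    by (rule sobolev1_exp_growth[OF y(3)]) (rule that)
  obtain D where D: "\<And>a. cmod (odd_part y a) \<le> D * 2 ^ nat \<bar>a\<bar>" 
    by (rule sobolev1_exp_growth[OF y(4)]) (rule that)
  have CD: "0 \<le> C" "0 \<le> D"
    using order.trans[OF norm_ge_zero C[of 0]] order.trans[OF norm_ge_zero D[of 0]] by simp_all
  \<comment> \<open>Index j sits at frequency j k, so growth with base 2 in frequency becomes base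
    2^k in the index.\<close>
  have "cmod (q j) \<le> (2 * (C + D)) * (2 ^ nat k) ^ j" for j
  proof -
    have "cmod (y (int j)) \<le> cmod (even_part y (int j * k)) + cmod (odd_part y (int j * k))" by simp
    also have "\<dots> \<le> (C + D) * 2 ^ nat \<bar>int j * k\<bar>"
      using C[of "int j * k"] D[of "int j * k"] by (simp add: distrib_right)
    also have "nat \<bar>int j * k\<bar> = nat k * j" using k_pos by (simp add: abs_mult nat_mult_distrib)
    finally have le: "cmod (y (int j)) \<le> (C + D) * (2 ^ nat k) ^ j" by (simp only: power_mult)
    have "cmod (q j) \<le> 2 * cmod (y (int j))"
      by (auto simp: q_def qsign_def norm_mult norm_power)
    also have "\<dots> \<le> 2 * ((C + D) * (2 ^ nat k) ^ j)" using le by simp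
    finally show ?thesis by (simp only: mult.assoc)
  qed
  moreover have "q \<noteq> (\<lambda>_. 0)"
  proof
    assume "q = (\<lambda>_. 0)"
    then have "q j = 0" for j by simp
    then have "(if j = 0 then y 0 else 2 * y (int j)) = 0" for j by (simp add: q_def)
    note * = this
    have z: "y (int j) = 0" for j using *[of j] by (cases "j = 0") simp_all
    have "y i = 0" for i using z[of "nat i"] z[of "nat (- i)"] y(2)[of i] by (cases "0 \<le> i") auto
    with y(1) show False by auto
  qed
  ultimately show "G k n \<mu> = 0"
    using G_eq_0_if_bounded_solution[OF sol assms, of "2 * (C + D)" "2 ^ nat k"] by simp
next
  assume G: "G k n \<mu> = 0"
  \<comment> \<open>This inverts the passage from y to q: \<open>qsign\<close> is its own inverse,
    and the factor 2 at nonzero frequencies is undone.\<close>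
  define y :: "int \<Rightarrow> complex" where
    "y i = qsign (nat \<bar>i\<bar>) * of_real (sol \<mu> (nat \<bar>i\<bar>)) * (if i = 0 then 1 else 1 / 2)" for i
  have sym: "y (- i) = y i" for i by (simp add: y_def)
  have "(\<lambda>j. qsign j * (if j = 0 then y 0 else 2 * y (int j))) = (\<lambda>j. of_real (sol \<mu> j))"
    by (rule ext) (auto simp: y_def simp flip: mult.assoc)
  then have eq: "\<forall>i. chain_eq \<mu> y i"
    using solves_recurrence_iff_chain_eq[of y \<mu>, OF sym] solves_recurrence_sol[OF assms G] by simp
  \<comment> \<open>Rate 2^k in the index is exactly what yields decay (1/2)^|a| in the frequency a
    = i k.\<close>
  obtain C where C: "0 < C" "\<And>j. \<bar>sol \<mu> j\<bar> * (2 ^ nat k) ^ j \<le> C"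
    using sol_decay[OF assms, of "2 ^ nat k"] by auto
  have y_le: "cmod (y i) \<le> C * (1 / 2) ^ nat \<bar>i * k\<bar>" for i
  proof -
    have "nat \<bar>i * k\<bar> = nat k * nat \<bar>i\<bar>" using k_pos by (simp add: abs_mult nat_mult_distrib)
    then have "\<bar>sol \<mu> (nat \<bar>i\<bar>)\<bar> \<le> C * (1 / 2) ^ nat \<bar>i * k\<bar>"
      using C(2)[of "nat \<bar>i\<bar>"] by (simp add: power_mult power_divide pos_le_divide_eq)
    moreover have "cmod (y i) \<le> \<bar>sol \<mu> (nat \<bar>i\<bar>)\<bar>"
      by (auto simp: y_def qsign_def norm_mult norm_power)
    ultimately show ?thesis by linarith
  qed
  have part_le: "cmod (even_part y a) \<le> C * (1 / 2) ^ nat \<bar>a\<bar>" "cmod (odd_part y a) \<le> C * (1 / 2) ^ nat \<bar>a\<bar>" for a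
    using y_le[of "a div k"] C(1) by (auto simp: even_part_def odd_part_def)
  have "y 1 \<noteq> 0" using sol_pos[OF assms, of 1] by (simp add: y_def)
  then have "y \<noteq> (\<lambda>_. 0)" by auto
  then show "\<exists>y. y \<noteq> (\<lambda>_. 0) \<and> (\<forall>i. y (- i) = y i) \<and> even_part y \<in> sobolev1 s \<and>
      odd_part y \<in> sobolev1 (s - 1) \<and> (\<forall>i. chain_eq \<mu> y i)"
    using sym eq sobolev1_exp_decay[OF part_le(1)] sobolev1_exp_decay[OF part_le(2)] by blast
qed

lemma chain_eigenvalue_pos_iff:
  assumes root: "0 < \<mu>" "G k n \<mu> = 0" and "0 < l"
  shows "chain_eigenvalue s k n (of_real l) \<longleftrightarrow> l = of_int n * of_int k * \<mu> / 2"
proof -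
  \<comment> \<open>Every positive l is rescaled to a parameter of the recurrence, so uniqueness of
    the eigenvalue reduces to uniqueness of the root.\<close>
  define \<nu> where "\<nu> = 2 * l / (of_int n * of_int k)"
  have nk: "(0 :: real) < of_int n * of_int k" using n_pos k_pos by simp
  have \<nu>: "0 < \<nu>" using nk assms by (simp add: \<nu>_def)
  have l: "l = of_int n * of_int k * \<nu> / 2" using n_pos k_pos by (simp add: \<nu>_def)
  have "chain_eigenvalue s k n (of_real l) \<longleftrightarrow> G k n \<nu> = 0"
    unfolding l by (rule chain_eigenvalue_iff_G[OF \<nu>])
  also have "\<dots> \<longleftrightarrow> \<nu> = \<mu>"
    using Lam_root_unique[OF \<nu> root(1)] root by (auto simp: G_eq_0_iff \<nu>)
  also have "\<dots> \<longleftrightarrow> l = of_int n * of_int k * \<mu> / 2" 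
    unfolding l using n_pos k_pos by auto
  finally show ?thesis .
qed

end

theorem proposition3p9:
  fixes k n :: int
  assumes "1 \<le> n" and "n < k"
  shows
    "(\<forall>j\<ge>2.
        (\<forall>\<mu>>0. (\<lambda>N. fin_cf k n \<mu> N j) \<longlonglongrightarrow> cf k n j \<mu> \<and> 0 < cf k n j \<mu> \<and>
            cf k n j \<mu> = coef k n (j - 1) / (\<mu> + coef k n (j + 1) * cf k n (j + 1) \<mu>)) \<and>
        continuous_on {0<..} (cf k n j)) \<and>
     (\<forall>\<mu>>0.
        (\<exists>q. q \<noteq> (\<lambda>_. 0) \<and> summable (\<lambda>j. (cmod (q j))\<^sup>2) \<and> solves_recurrence k n \<mu> q)
          \<longleftrightarrow> G k n \<mu> = 0) \<and>
     (\<exists>\<mu>\<^sub>k\<^sub>n>0.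
        (\<forall>\<mu>>0. G k n \<mu> = 0 \<longleftrightarrow> \<mu> = \<mu>\<^sub>k\<^sub>n) \<and>
        (\<forall>s\<ge>0. (\<exists>!l::real. 0 < l \<and> chain_eigenvalue s k n (of_real l)) \<and>
            lambda_kn s k n = of_int n * of_int k * \<mu>\<^sub>k\<^sub>n / 2) \<and>
        max 0 (- coef k n 0 * coef k n 1 - coef k n 1 * coef k n 2) \<le> \<mu>\<^sub>k\<^sub>n\<^sup>2 \<and>
        \<mu>\<^sub>k\<^sub>n\<^sup>2 < - coef k n 0 * coef k n 1)"
proof -
  interpret chain k n using assms by unfold_locales
  obtain \<mu> where \<mu>: "0 < \<mu>" "Lam \<mu> = 0" using ex_Lam_root by blast
  have root: "G k n \<mu> = 0" using \<mu> by (simp add: G_eq_0_iff)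
  define l where "l = of_int n * of_int k * \<mu> / 2"
  have l: "0 < l" using \<mu> n_pos k_pos by (simp add: l_def)
  \<comment> \<open>Stated as a conjunction so that it rewrites both the body of the
    unique-existence claim and the description defining \<open>lambda_kn\<close>.\<close>
  have eig: "0 < x \<and> chain_eigenvalue s k n (of_real x) \<longleftrightarrow> x = l" for x s
    using chain_eigenvalue_pos_iff[OF \<mu>(1) root, of x s] l by (auto simp flip: l_def)
  show ?thesis
  proof (intro conjI allI impI exI[of _ \<mu>])
    fix \<nu> :: real
    assume \<nu>: "0 < \<nu>"
    then show "G k n \<nu> = 0 \<longleftrightarrow> \<nu> = \<mu>"
      using Lam_root_unique[OF \<mu>(1) \<nu> \<mu>(2)] \<mu>(2) by (auto simp: G_eq_0_iff)
    show "(\<exists>q. q \<noteq> (\<lambda>_. 0) \<and> summable (\<lambda>j. (cmod (q j))\<^sup>2) \<and> solves_recurrence k n \<nu> q) \<longleftrightarrow> G k n \<nu> = 0"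
      using \<nu> by (rule square_summable_solution_iff)
  next
    fix s :: real
    show "\<exists>!x. 0 < x \<and> chain_eigenvalue s k n (of_real x)" unfolding eig by simp
    show "lambda_kn s k n = of_int n * of_int k * \<mu> / 2"
      unfolding lambda_kn_def eig l_def[symmetric] by simp
  next
    show "max 0 (- c 0 * c 1 - c 1 * c 2) \<le> \<mu>\<^sup>2" "\<mu>\<^sup>2 < - c 0 * c 1"
      using Lam_eq_0_bounds[OF \<mu>] by simp_all
  next
    fix j :: nat and \<nu> :: real
    assume "2 \<le> j" "0 < \<nu>"
    then show "(\<lambda>N. fin_cf k n \<nu> N j) \<longlonglongrightarrow> cf k n j \<nu>" "0 < cf k n j \<nu>"
      "cf k n j \<nu> = coef k n (j - 1) / (\<nu> + coef k n (j + 1) * cf k n (j + 1) \<nu>)"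
      using fin_cf_tendsto[of \<nu> j] cf_pos[of \<nu> j] cf_rec[of \<nu> j] by simp_all
  qed (use \<mu>(1) continuous_on_cf in simp_all)
qed

end
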